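(* Let $B$ be a division quaternion algebra over $\mathbb{Q}$, let $p$ be an odd prime at which $B$ ramifies, and let $a_0,\dots,a_n$ (for some $n\ge0$) be a sequence of elements of $B$. Assume that there exists a maximal order $R\subset B$ such that for all $i,j\in\{0,\dots,n\}$: - $|a_i|_p>1$; - $a_i\in R_q$ for every prime $q\neq p$; - if $|a_i-a_j|_p<1$, then $a_i=a_j$; - $\dfrac{\theta(N_\infty(a_i))}{|a_i|_p}<1$. Define $A_{-1}=1$, $A_0=a_0$, $A_m=A_{m-1}a_m+A_{m-2}$ and $B_{-1}=0$, $B_0=1$, $B_m=B_{m-1}a_m+B_{m-2}$ for $1\le m\le n$. Then the polynomial $$XB_nX+XB_{n-1}-A_nX-A_{n-1}$$ has no root in $B$; that is, there is no $x\in B$ with $xB_nx+xB_{n-1}-A_nx-A_{n-1}=0$.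
   Context: $B$ ramified at $p$ means that $B\otimes_{\mathbb{Q}}\mathbb{Q}_p$ is a division algebra; on it $|\alpha|_p=p^{-v_p(\mathrm{nrd}(\alpha))/2}$, with $\mathrm{nrd}$ the reduced norm, is a non-archimedean absolute value. For a prime $q$, $R_q=R\otimes_{\mathbb{Z}}\mathbb{Z}_q\subset B\otimes_{\mathbb{Q}}\mathbb{Q}_q$. (The elements $B_m\in B$ defined by recursion are not to be confused with completions of $B$.) $N_\infty$ is the operator norm (with respect to the Euclidean norm on vectors) on $B\otimes_{\mathbb{Q}}\mathbb{R}$, after fixing an isomorphism $B\otimes_{\mathbb{Q}}\mathbb{R}\cong M_2(\mathbb{R})$ if $B$ is indefinite, or an embedding of $B\otimes_{\mathbb{Q}}\mathbb{R}$ (the real Hamilton quaternions) in $M_2(\mathbb{C})$ if $B$ is definite. For $x\in\mathbb{C}$, $\theta(x)=\frac12\left(|x|_\infty+\sqrt{|x|_\infty^2+4}\right)$, where $|\cdot|_\infty$ is the usual absolute value. *)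

theory Defs
  imports "HOL-Analysis.Analysis" "HOL-Algebra.QuotRing"
    "HOL-Algebra.Algebraic_Closure_Type"
begin

section \<open>The field of \<open>p\<close>-adic numbers\<close>

definition rat_val :: "nat \<Rightarrow> rat \<Rightarrow> int" where
  "rat_val p r = int (multiplicity (int p) (fst (quotient_of r)))
               - int (multiplicity (int p) (snd (quotient_of r)))"

definition rat_abs :: "nat \<Rightarrow> rat \<Rightarrow> real" where
  "rat_abs p r = (if r = 0 then 0 else real p powi (- rat_val p r))"

definition padic_Cauchy :: "nat \<Rightarrow> (nat \<Rightarrow> rat) \<Rightarrow> bool" where
  "padic_Cauchy p s \<longleftrightarrow> (\<forall>e>0. \<exists>N. \<forall>m\<ge>N. \<forall>n\<ge>N. rat_abs p (s m - s n) < e)"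

definition Cauchy_ring :: "nat \<Rightarrow> (nat \<Rightarrow> rat) ring" where
  "Cauchy_ring p = \<lparr>carrier = {s. padic_Cauchy p s}, mult = (\<lambda>s t n. s n * t n), one = (\<lambda>n. 1),
                    ring.zero = (\<lambda>n. 0), ring.add = (\<lambda>s t n. s n + t n)\<rparr>"

definition null_ideal :: "nat \<Rightarrow> (nat \<Rightarrow> rat) set" where
  "null_ideal p = {s. (\<lambda>n. rat_abs p (s n)) \<longlonglongrightarrow> 0}"

text \<open>The field \<open>\<rat>\<^sub>p\<close> is the completion of \<open>\<rat>\<close>: Cauchy sequences modulo null sequences.\<close>

definition Qp :: "nat \<Rightarrow> (nat \<Rightarrow> rat) set ring" where
  "Qp p = Cauchy_ring p Quot null_ideal p"

definition rat_to_Qp :: "nat \<Rightarrow> rat \<Rightarrow> (nat \<Rightarrow> rat) set" where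
  "rat_to_Qp p r = null_ideal p +>\<^bsub>Cauchy_ring p\<^esub> (\<lambda>n. r)"

definition Qp_abs :: "nat \<Rightarrow> (nat \<Rightarrow> rat) set \<Rightarrow> real" where
  "Qp_abs p x = (THE L. \<forall>s\<in>x. (\<lambda>n. rat_abs p (s n)) \<longlonglongrightarrow> L)"

definition Zp :: "nat \<Rightarrow> (nat \<Rightarrow> rat) set set" where
  "Zp p = {x \<in> carrier (Qp p). Qp_abs p x \<le> 1}"


section \<open>Quaternion algebras over the rationals\<close>

text \<open>A quaternion algebra over \<open>\<rat>\<close>, with scalar multiplication \<open>scl\<close>, comes with generators
  \<open>i\<close>, \<open>j\<close> such that \<open>i\<^sup>2 = c\<close>, \<open>j\<^sup>2 = d\<close>, \<open>j i = - i j\<close> for nonzero rationals \<open>c\<close>, \<open>d\<close>,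
  and \<open>1, i, j, i j\<close> is a basis. The notions below are written in the coordinates of such a
  presentation, but do not depend on it.\<close>

locale quaternion_algebra = vector_space scl
  for scl :: "rat \<Rightarrow> 'b::ring_1 \<Rightarrow> 'b" +
  fixes c d :: rat and i j :: 'b
  assumes scale_mult_left: "scl r x * y = scl r (x * y)"
    and scale_mult_right: "x * scl r y = scl r (x * y)"
    and nonzero: "c \<noteq> 0" "d \<noteq> 0"
    and i_square: "i * i = scl c 1"
    and j_square: "j * j = scl d 1"
    and anticommute: "j * i = - (i * j)"
    and distinct_basis: "distinct [1, i, j, i * j]"
    and independent_basis: "independent {1, i, j, i * j}"
    and span_basis: "span {1, i, j, i * j} = UNIV"

type_synonym 'k quad = "'k \<times> 'k \<times> 'k \<times> 'k"

definition coords :: "(rat \<Rightarrow> 'b::ring_1 \<Rightarrow> 'b) \<Rightarrow> 'b \<Rightarrow> 'b \<Rightarrow> 'b \<Rightarrow> rat quad" where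
  "coords scl i j x =
     (let f = module.representation scl {1, i, j, i * j} x in (f 1, f i, f j, f (i * j)))"

definition nrd :: "(rat \<Rightarrow> 'b::ring_1 \<Rightarrow> 'b) \<Rightarrow> rat \<Rightarrow> rat \<Rightarrow> 'b \<Rightarrow> 'b \<Rightarrow> 'b \<Rightarrow> rat" where
  "nrd scl c d i j x =
     (case coords scl i j x of (t, u, v, w) \<Rightarrow> t\<^sup>2 - c * u\<^sup>2 - d * v\<^sup>2 + c * d * w\<^sup>2)"

text \<open>The restriction to \<open>B\<close> of the absolute value of \<open>B \<otimes> \<rat>\<^sub>p\<close>.\<close>

definition quat_abs ::
    "(rat \<Rightarrow> 'b::ring_1 \<Rightarrow> 'b) \<Rightarrow> rat \<Rightarrow> rat \<Rightarrow> 'b \<Rightarrow> 'b \<Rightarrow> nat \<Rightarrow> 'b \<Rightarrow> real" where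
  "quat_abs scl c d i j p x =
     (if x = 0 then 0 else real p powr (- real_of_int (rat_val p (nrd scl c d i j x)) / 2))"


subsection \<open>Base change\<close>

text \<open>The quaternion algebra with parameters \<open>c\<close>, \<open>d\<close> over a commutative ring \<open>K\<close>, on coordinates
  with respect to \<open>1, i, j, i j\<close>. For \<open>c\<close>, \<open>d\<close> the images of the rational parameters of \<open>B\<close>
  under \<open>\<rat> \<rightarrow> K\<close> this is \<open>B \<otimes> K\<close>, the map \<open>x \<mapsto> x \<otimes> 1\<close> being given by the
  images of the coordinates of \<open>x\<close>.\<close>

definition quat_ring :: "('k, 'm) ring_scheme \<Rightarrow> 'k \<Rightarrow> 'k \<Rightarrow> 'k quad ring" where
  "quat_ring K c d =
    \<lparr>carrier = carrier K \<times> carrier K \<times> carrier K \<times> carrier K,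
     mult = (\<lambda>(t, u, v, w) (t', u', v', w').
       (((t \<otimes>\<^bsub>K\<^esub> t' \<oplus>\<^bsub>K\<^esub> c \<otimes>\<^bsub>K\<^esub> (u \<otimes>\<^bsub>K\<^esub> u')) \<oplus>\<^bsub>K\<^esub> d \<otimes>\<^bsub>K\<^esub> (v \<otimes>\<^bsub>K\<^esub> v'))
            \<ominus>\<^bsub>K\<^esub> (c \<otimes>\<^bsub>K\<^esub> d) \<otimes>\<^bsub>K\<^esub> (w \<otimes>\<^bsub>K\<^esub> w'),
        (t \<otimes>\<^bsub>K\<^esub> u' \<oplus>\<^bsub>K\<^esub> u \<otimes>\<^bsub>K\<^esub> t') \<oplus>\<^bsub>K\<^esub> d \<otimes>\<^bsub>K\<^esub> (w \<otimes>\<^bsub>K\<^esub> v' \<ominus>\<^bsub>K\<^esub> v \<otimes>\<^bsub>K\<^esub> w'),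
        (t \<otimes>\<^bsub>K\<^esub> v' \<oplus>\<^bsub>K\<^esub> v \<otimes>\<^bsub>K\<^esub> t') \<oplus>\<^bsub>K\<^esub> c \<otimes>\<^bsub>K\<^esub> (u \<otimes>\<^bsub>K\<^esub> w' \<ominus>\<^bsub>K\<^esub> w \<otimes>\<^bsub>K\<^esub> u'),
        (t \<otimes>\<^bsub>K\<^esub> w' \<oplus>\<^bsub>K\<^esub> w \<otimes>\<^bsub>K\<^esub> t') \<oplus>\<^bsub>K\<^esub> (u \<otimes>\<^bsub>K\<^esub> v' \<ominus>\<^bsub>K\<^esub> v \<otimes>\<^bsub>K\<^esub> u'))),
     one = (\<one>\<^bsub>K\<^esub>, \<zero>\<^bsub>K\<^esub>, \<zero>\<^bsub>K\<^esub>, \<zero>\<^bsub>K\<^esub>),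
     ring.zero = (\<zero>\<^bsub>K\<^esub>, \<zero>\<^bsub>K\<^esub>, \<zero>\<^bsub>K\<^esub>, \<zero>\<^bsub>K\<^esub>),
     ring.add = (\<lambda>(t, u, v, w) (t', u', v', w').
       (t \<oplus>\<^bsub>K\<^esub> t', u \<oplus>\<^bsub>K\<^esub> u', v \<oplus>\<^bsub>K\<^esub> v', w \<oplus>\<^bsub>K\<^esub> w'))\<rparr>"

definition map_quad :: "('a \<Rightarrow> 'k) \<Rightarrow> 'a quad \<Rightarrow> 'k quad" where
  "map_quad f = (\<lambda>(t, u, v, w). (f t, f u, f v, f w))"

definition is_division :: "('a, 'm) ring_scheme \<Rightarrow> bool" where
  "is_division D \<longleftrightarrow> ring D \<and> Units D = carrier D - {\<zero>\<^bsub>D\<^esub>}"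

definition quat_Qp :: "rat \<Rightarrow> rat \<Rightarrow> nat \<Rightarrow> (nat \<Rightarrow> rat) set quad ring" where
  "quat_Qp c d p = quat_ring (Qp p) (rat_to_Qp p c) (rat_to_Qp p d)"

definition to_quat_Qp ::
    "(rat \<Rightarrow> 'b::ring_1 \<Rightarrow> 'b) \<Rightarrow> 'b \<Rightarrow> 'b \<Rightarrow> nat \<Rightarrow> 'b \<Rightarrow> (nat \<Rightarrow> rat) set quad" where
  "to_quat_Qp scl i j p x = map_quad (rat_to_Qp p) (coords scl i j x)"

definition ramified_at :: "rat \<Rightarrow> rat \<Rightarrow> nat \<Rightarrow> bool" where
  "ramified_at c d p \<longleftrightarrow> is_division (quat_Qp c d p)"

definition quat_real :: "rat \<Rightarrow> rat \<Rightarrow> real quad ring" where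
  "quat_real c d = quat_ring (ring_of_type_algebra :: real ring) (of_rat c) (of_rat d)"

definition to_quat_real ::
    "(rat \<Rightarrow> 'b::ring_1 \<Rightarrow> 'b) \<Rightarrow> 'b \<Rightarrow> 'b \<Rightarrow> 'b \<Rightarrow> real quad" where
  "to_quat_real scl i j x = map_quad of_rat (coords scl i j x)"

definition definite :: "rat \<Rightarrow> rat \<Rightarrow> bool" where
  "definite c d \<longleftrightarrow> is_division (quat_real c d)"


subsection \<open>Orders\<close>

definition is_order :: "(rat \<Rightarrow> 'b::ring_1 \<Rightarrow> 'b) \<Rightarrow> 'b set \<Rightarrow> bool" where
  "is_order scl R \<longleftrightarrow>
     1 \<in> R \<and> (\<forall>x\<in>R. \<forall>y\<in>R. x * y \<in> R) \<and>
     (\<exists>S. finite S \<and> R = module.span (\<lambda>(k::int) x. of_int k * x) S) \<and>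
     module.span scl R = UNIV"

definition maximal_order :: "(rat \<Rightarrow> 'b::ring_1 \<Rightarrow> 'b) \<Rightarrow> 'b set \<Rightarrow> bool" where
  "maximal_order scl R \<longleftrightarrow>
     is_order scl R \<and> (\<forall>R'. is_order scl R' \<and> R \<subseteq> R' \<longrightarrow> R' = R)"

text \<open>The image of \<open>R \<otimes> \<int>\<^sub>q\<close> in \<open>B \<otimes> \<rat>\<^sub>q\<close>: finite sums of elements \<open>r \<otimes> z\<close>.\<close>

definition local_order ::
    "(rat \<Rightarrow> 'b::ring_1 \<Rightarrow> 'b) \<Rightarrow> rat \<Rightarrow> rat \<Rightarrow> 'b \<Rightarrow> 'b \<Rightarrow> 'b set \<Rightarrow> nat
      \<Rightarrow> (nat \<Rightarrow> rat) set quad set" where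
  "local_order scl c d i j R q =
     generate (add_monoid (quat_Qp c d q))
       {map_quad (\<lambda>y. z \<otimes>\<^bsub>Qp q\<^esub> y) (to_quat_Qp scl i j q r) | z r. z \<in> Zp q \<and> r \<in> R}"


subsection \<open>The archimedean norm\<close>

text \<open>Unital homomorphisms of real algebras from \<open>B \<otimes> \<real>\<close> to 2-by-2 matrices over \<open>'k\<close>.\<close>

definition real_alg_hom :: "rat \<Rightarrow> rat \<Rightarrow> (real quad \<Rightarrow> 'k::real_algebra_1 ^ 2 ^ 2) \<Rightarrow> bool" where
  "real_alg_hom c d \<phi> \<longleftrightarrow>
     linear \<phi> \<and> \<phi> \<one>\<^bsub>quat_real c d\<^esub> = mat 1 \<and>
     (\<forall>x y. \<phi> (x \<otimes>\<^bsub>quat_real c d\<^esub> y) = \<phi> x ** \<phi> y)"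

text \<open>\<open>N\<close> is the operator norm on \<open>B \<otimes> \<real>\<close> for some choice of isomorphism with
  \<open>M\<^sub>2(\<real>)\<close> (indefinite case) or of embedding in \<open>M\<^sub>2(\<complex>)\<close> (definite case).\<close>

definition is_arch_norm :: "rat \<Rightarrow> rat \<Rightarrow> (real quad \<Rightarrow> real) \<Rightarrow> bool" where
  "is_arch_norm c d N \<longleftrightarrow>
     (if definite c d
      then \<exists>\<phi> :: real quad \<Rightarrow> complex ^ 2 ^ 2.
             real_alg_hom c d \<phi> \<and> inj \<phi> \<and> N = (\<lambda>x. onorm (\<lambda>v. \<phi> x *v v))
      else \<exists>\<phi> :: real quad \<Rightarrow> real ^ 2 ^ 2.
             real_alg_hom c d \<phi> \<and> bij \<phi> \<and> N = (\<lambda>x. onorm (\<lambda>v. \<phi> x *v v)))"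

definition theta :: "complex \<Rightarrow> real" where
  "theta x = (cmod x + sqrt ((cmod x)\<^sup>2 + 4)) / 2"


section \<open>Continuants\<close>

text \<open>Indices are shifted by one: \<open>contA a m\<close> and \<open>contB a m\<close> are \<open>A\<^sub>m\<^sub>-\<^sub>1\<close> and \<open>B\<^sub>m\<^sub>-\<^sub>1\<close>.\<close>

fun contA :: "(nat \<Rightarrow> 'b::ring_1) \<Rightarrow> nat \<Rightarrow> 'b" where
  "contA a 0 = 1"
| "contA a (Suc 0) = a 0"
| "contA a (Suc (Suc m)) = contA a (Suc m) * a (Suc m) + contA a m"

fun contB :: "(nat \<Rightarrow> 'b::ring_1) \<Rightarrow> nat \<Rightarrow> 'b" where
  "contB a 0 = 0"
| "contB a (Suc 0) = 1"
| "contB a (Suc (Suc m)) = contB a (Suc m) * a (Suc m) + contB a m"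

end

theory Submission
  imports Defs
begin

text \<open>
  A root \<open>x\<close> of the polynomial satisfies \<open>A\<^sub>n x + A\<^sub>n\<^sub>-\<^sub>1 = x (B\<^sub>n x + B\<^sub>n\<^sub>-\<^sub>1)\<close>. With
  \<open>\<mu> = B\<^sub>n x + B\<^sub>n\<^sub>-\<^sub>1\<close> this says that the column vector \<open>w = (x, 1)\<close> is an eigenvector,
  \<open>M w = w \<mu>\<close>, of the product \<open>M\<close> of the matrices with rows \<open>(a\<^sub>k, 1)\<close> and \<open>(1, 0)\<close>. The proof
  measures \<open>\<mu>\<close> in two ways. Write \<open>P\<close> for the product of the \<open>|a\<^sub>k|\<^sub>p\<close> and \<open>\<Theta>\<close> for the product of the
  \<open>\<theta>(N\<^sub>\<infinity>(a\<^sub>k))\<close>, so that \<open>\<Theta> < P\<close> by hypothesis.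

  \<^item> Arithmetic bound (\<open>eigenvalue_bound\<close>): \<open>|\<mu>|\<^sub>p \<Theta> \<ge> 1\<close>. The vectors \<open>M\<^sup>k w = w \<mu>\<^sup>k\<close>
    have coordinates in \<open>R[1/p]\<close> up to a denominator independent of \<open>k\<close>, and grow at most like \<open>\<Theta>\<^sup>k\<close>,
    because each factor of \<open>M\<close> has norm at most the corresponding \<open>\<theta>\<close> (\<open>theta_bound\<close>). The
    reduced norm of a nonzero coordinate is a nonzero rational number with denominator a power of \<open>p\<close>, up to a
    constant, so that its usual and its \<open>p\<close>-adic absolute value have a product bounded below
    (\<open>product_formula_bound\<close>). Letting \<open>k\<close> grow gives the claim.

  \<^item> Dynamical computation (\<open>cf_apply_vabs\<close>): if \<open>|x|\<^sub>p \<ge> 1\<close>, then each step multiplies the first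
    coordinate by exactly \<open>|a\<^sub>k|\<^sub>p\<close>, whence \<open>|\<mu>|\<^sub>p = P\<close>.

  The inverse of \<open>M\<close> is a product of the same shape, with entries \<open>- a\<^sub>k\<close> in reverse order, after
  exchanging the coordinates (\<open>cf_apply_inverse\<close>), and its eigenvalue is \<open>\<mu>\<^sup>-\<^sup>1\<close>. If \<open>|x|\<^sub>p \<ge> 1\<close>, the
  computation for \<open>M\<close> and the bound for the inverse give \<open>\<Theta> / P \<ge> 1\<close>, a contradiction. If \<open>|x|\<^sub>p < 1\<close>,
  the vector \<open>(1, x)\<close> is dominated by its first coordinate and the roles of \<open>M\<close> and its inverse
  are exchanged.

  Two ingredients need the local hypotheses. The \<open>p\<close>-adic absolute value on \<open>B\<close> is ultrametric
  (\<open>vabs_add\<close>) because \<open>B\<close> ramifies at \<open>p\<close>: an element of integral norm but non-integral trace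
  would, by Hensel's lemma, produce zero divisors in \<open>B \<otimes> \<rat>\<^sub>p\<close>. And integrality at all primes other
  than \<open>p\<close> puts the \<open>a\<^sub>k\<close> in \<open>R[1/p]\<close> (\<open>local_order_integral\<close>, \<open>order_at_all_imp_order_away\<close>).
\<close>

section \<open>The \<open>p\<close>-adic absolute value on the rationals\<close>

locale rational_prime =
  fixes p :: nat
  assumes prime_p: "Factorial_Ring.prime p"
begin

lemma p_gt_1: "real p > 1"
  using prime_gt_1_nat[OF prime_p] by simp

lemma prime_int_p: "Factorial_Ring.prime (int p)"
  using prime_p by simp

text \<open>The valuation is defined through reduced fractions; its multiplicativity rests on being able to
  compute it from any fraction.\<close>

lemma rat_val_fraction:
  assumes "a \<noteq> 0" "b \<noteq> 0"
  shows "rat_val p (of_int a / of_int b) = int (multiplicity (int p) a) - int (multiplicity (int p) b)"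
proof -
  obtain n e where q: "quotient_of (of_int a / of_int b) = (n, e)"
    by (cases "quotient_of (of_int a / of_int b :: rat)")
  then have e: "e > 0" by (rule quotient_of_denom_pos)
  have eq: "(of_int a / of_int b :: rat) = of_int n / of_int e"
    by (rule quotient_of_div[OF q])
  then have "(of_int (a * e) :: rat) = of_int (n * b)"
    using e assms by (simp add: field_simps)
  then have ae: "a * e = n * b" by (simp only: of_int_eq_iff)
  then have n: "n \<noteq> 0" using assms e by auto
  have "multiplicity (int p) (a * e) = multiplicity (int p) a + multiplicity (int p) e"
    using prime_int_p assms e by (intro prime_elem_multiplicity_mult_distrib) auto
  moreover have "multiplicity (int p) (n * b) = multiplicity (int p) n + multiplicity (int p) b"
    using prime_int_p assms n by (intro prime_elem_multiplicity_mult_distrib) auto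
  ultimately show ?thesis using ae unfolding rat_val_def q by simp
qed

lemma fraction_cases:
  fixes x :: rat
  assumes "x \<noteq> 0"
  obtains a b :: int where "x = of_int a / of_int b" "a \<noteq> 0" "b \<noteq> 0"
proof -
  obtain a b where q: "quotient_of x = (a, b)" by (cases "quotient_of x")
  have "b > 0" "x = of_int a / of_int b"
    using quotient_of_denom_pos[OF q] quotient_of_div[OF q] by auto
  with assms that show thesis by (cases "a = 0") auto
qed

lemma rat_val_mult:
  assumes "x \<noteq> 0" "y \<noteq> 0"
  shows "rat_val p (x * y) = rat_val p x + rat_val p y"
proof -
  obtain a b where x: "x = of_int a / of_int b" "a \<noteq> 0" "b \<noteq> 0" by (rule fraction_cases[OF assms(1)])
  obtain e f where y: "y = of_int e / of_int f" "e \<noteq> 0" "f \<noteq> 0" by (rule fraction_cases[OF assms(2)])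
  have "x * y = of_int (a * e) / of_int (b * f)" by (simp add: x y)
  then have "rat_val p (x * y) = int (multiplicity (int p) (a * e)) - int (multiplicity (int p) (b * f))"
    using x y by (simp only: rat_val_fraction mult_eq_0_iff simp_thms)
  also have "\<dots> = rat_val p x + rat_val p y"
    using x y prime_int_p by (simp add: rat_val_fraction prime_elem_multiplicity_mult_distrib)
  finally show ?thesis .
qed

lemma rat_abs_0 [simp]: "rat_abs p 0 = 0"
  by (simp add: rat_abs_def)

lemma rat_abs_eq_0_iff [simp]: "rat_abs p x = 0 \<longleftrightarrow> x = 0"
  using p_gt_1 by (simp add: rat_abs_def)

lemma rat_abs_nonneg [simp]: "rat_abs p x \<ge> 0"
  by (simp add: rat_abs_def)

lemma rat_abs_mult: "rat_abs p (x * y) = rat_abs p x * rat_abs p y"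
  using p_gt_1 by (auto simp: rat_abs_def rat_val_mult power_int_add[symmetric])

lemma rat_abs_1 [simp]: "rat_abs p 1 = 1"
  using rat_abs_mult[of 1 1] by simp

lemma rat_abs_power: "rat_abs p (x ^ k) = rat_abs p x ^ k"
  by (induction k) (auto simp: rat_abs_mult)

lemma rat_abs_minus [simp]: "rat_abs p (- x) = rat_abs p x"
proof -
  have "rat_abs p (-1) ^ 2 = rat_abs p ((-1) ^ 2)" by (simp only: rat_abs_power)
  then have "rat_abs p (-1) = 1" using rat_abs_nonneg[of "-1"] by (simp add: power2_eq_1_iff)
  then show ?thesis using rat_abs_mult[of "-1" x] by simp
qed

lemma rat_abs_minus_commute: "rat_abs p (x - y) = rat_abs p (y - x)"
  using rat_abs_minus[of "x - y"] by simp

lemma rat_abs_inverse: "rat_abs p (inverse x) = inverse (rat_abs p x)"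
proof (cases "x = 0")
  case False
  then have "rat_abs p (inverse x) * rat_abs p x = 1" by (simp flip: rat_abs_mult)
  then show ?thesis by (metis inverse_unique mult.commute)
qed simp

lemma rat_abs_divide: "rat_abs p (x / y) = rat_abs p x / rat_abs p y"
  by (simp add: divide_inverse rat_abs_mult rat_abs_inverse)

lemma rat_abs_of_int_le_1: "rat_abs p (of_int m) \<le> 1"
proof (cases "m = 0")
  case False
  then have "rat_val p (of_int m / of_int 1) = int (multiplicity (int p) m)"
    by (subst rat_val_fraction) auto
  then show ?thesis using False p_gt_1
    by (simp add: rat_abs_def power_int_minus field_simps)
qed simp

lemma rat_abs_prime: "rat_abs p (of_nat p) = 1 / real p"
proof -
  have "rat_val p (of_int (int p) / of_int 1) = 1"
    using p_gt_1 prime_int_p by (subst rat_val_fraction) (auto simp: multiplicity_self)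
  then show ?thesis using p_gt_1 by (simp add: rat_abs_def power_int_minus field_simps)
qed

lemma rat_abs_of_int_not_dvd:
  assumes "\<not> int p dvd m"
  shows "rat_abs p (of_int m) = 1"
proof -
  have "m \<noteq> 0" using assms by auto
  then have "rat_val p (of_int m / of_int 1) = 0"
    using assms by (subst rat_val_fraction) (auto simp: not_dvd_imp_multiplicity_0)
  with \<open>m \<noteq> 0\<close> show ?thesis by (simp add: rat_abs_def)
qed

text \<open>The values of the absolute value are integral powers of \<open>p\<close>.\<close>

lemma rat_abs_less_prime:
  assumes "rat_abs p x < real p"
  shows "rat_abs p x \<le> 1"
proof (rule ccontr)
  assume "\<not> rat_abs p x \<le> 1"
  then have x: "x \<noteq> 0" and gt: "real p powi (- rat_val p x) > 1" by (auto simp: rat_abs_def split: if_splits)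
  have "- rat_val p x \<ge> 1"
    using gt p_gt_1 power_int_increasing[of "- rat_val p x" 0 "real p"] by (cases "- rat_val p x \<ge> 1") auto
  then have "real p powi 1 \<le> real p powi (- rat_val p x)"
    using p_gt_1 by (intro power_int_increasing) auto
  with assms x show False by (simp add: rat_abs_def)
qed

lemma p_integral_fraction:
  assumes "rat_abs p x \<le> 1"
  obtains a b :: int where "x = of_int a / of_int b" "\<not> int p dvd b"
proof (cases "x = 0")
  case True
  then show thesis using that[of 0 1] p_gt_1 by simp
next
  case False
  obtain a b where q: "quotient_of x = (a, b)" by (cases "quotient_of x")
  have b: "b > 0" "x = of_int a / of_int b" and cop: "algebraic_semidom_class.coprime a b"
    using quotient_of_denom_pos[OF q] quotient_of_div[OF q] quotient_of_coprime[OF q] by auto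
  have a: "a \<noteq> 0" using b False by auto
  have "\<not> int p dvd b"
  proof
    assume dvd: "int p dvd b"
    have "\<not> is_unit (int p)" using prime_int_p not_prime_unit by blast
    then have "\<not> int p dvd a" using cop dvd coprime_common_divisor by blast
    then have 1: "multiplicity (int p) a = 0" by (rule not_dvd_imp_multiplicity_0)
    have 2: "multiplicity (int p) b \<ge> 1"
      using dvd b \<open>\<not> is_unit (int p)\<close> by (simp add: multiplicity_geI)
    have "- rat_val p x = int (multiplicity (int p) b)"
      using rat_val_fraction[of a b] a b 1 by simp
    then have "rat_abs p x = real p ^ multiplicity (int p) b" using False by (simp add: rat_abs_def)
    moreover have "real p ^ multiplicity (int p) b > 1" using 2 p_gt_1 by (simp add: one_less_power)
    ultimately show False using assms by simp
  qed
  with b that show thesis by blast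
qed

text \<open>Dividing by the larger summand reduces the ultrametric inequality to the fact that
  fractions with denominator prime to \<open>p\<close> are closed under addition.\<close>

lemma rat_abs_add: "rat_abs p (x + y) \<le> max (rat_abs p x) (rat_abs p y)"
proof -
  have one: "rat_abs p (1 + z) \<le> 1" if "rat_abs p z \<le> 1" for z
  proof -
    obtain a b where z: "z = of_int a / of_int b" "\<not> int p dvd b"
      by (rule p_integral_fraction[OF \<open>rat_abs p z \<le> 1\<close>])
    then have "b \<noteq> 0" by auto
    then have "1 + z = of_int (a + b) / of_int b" using z by (simp add: field_simps)
    then have "rat_abs p (1 + z) = rat_abs p (of_int (a + b))"
      using z rat_abs_of_int_not_dvd by (simp only: rat_abs_divide) simp
    then show ?thesis using rat_abs_of_int_le_1[of "a + b"] by simp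
  qed
  have main: "rat_abs p (u + v) \<le> rat_abs p u" if "rat_abs p v \<le> rat_abs p u" for u v
  proof (cases "u = 0")
    case True
    with that show ?thesis using rat_abs_nonneg[of v] by (simp add: order_antisym)
  next
    case False
    then have "rat_abs p u > 0" by (simp add: order_less_le)
    then have "rat_abs p (v / u) \<le> 1" using that by (simp add: rat_abs_divide)
    then have "rat_abs p u * rat_abs p (1 + v / u) \<le> rat_abs p u * 1"
      by (intro mult_left_mono one) auto
    moreover have "u * (1 + v / u) = u + v" using False by (simp add: field_simps)
    ultimately show ?thesis by (simp flip: rat_abs_mult)
  qed
  show ?thesis using main[of x y] main[of y x] by (cases "rat_abs p y \<le> rat_abs p x") (auto simp: add.commute)
qed

lemma rat_abs_diff: "rat_abs p (x - y) \<le> max (rat_abs p x) (rat_abs p y)"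
  using rat_abs_add[of x "- y"] by simp

text \<open>The product formula, for a number whose denominator is a power of \<open>p\<close>: the integer
  \<open>p\<^sup>e x\<close> is divisible by the exact power of \<open>p\<close> that its \<open>p\<close>-adic absolute value records.\<close>

lemma product_formula_bound:
  assumes x: "x \<noteq> 0" and int: "of_nat p ^ e * x \<in> \<int>"
  shows "rat_abs p x * \<bar>of_rat x\<bar> \<ge> 1"
proof -
  obtain m where m: "of_nat p ^ e * x = of_int m" using int by (auto elim: Ints_cases)
  have m0: "m \<noteq> 0" using m x p_gt_1 by auto
  define k where "k = multiplicity (int p) m"
  have "rat_val p (of_int m / of_int 1) = int k"
    using m0 unfolding k_def by (subst rat_val_fraction) auto
  then have absm: "rat_abs p (of_int m) = 1 / real p ^ k"
    using m0 by (simp add: rat_abs_def power_int_minus divide_inverse)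
  have "int p ^ k dvd m" unfolding k_def by (rule multiplicity_dvd)
  then have "int p ^ k \<le> \<bar>m\<bar>" using m0 dvd_imp_le_int[of m "int p ^ k"] by simp
  then have "of_int (int p ^ k) \<le> \<bar>real_of_int m\<bar>" by linarith
  then have "real p ^ k \<le> \<bar>real_of_int m\<bar>" by simp
  then have ge: "rat_abs p (of_int m) * \<bar>real_of_int m\<bar> \<ge> 1"
    using p_gt_1 unfolding absm by (simp add: le_divide_eq)
  have "of_rat (of_nat p ^ e * x) = real_of_int m" using m by simp
  then have "real p ^ e * of_rat x = real_of_int m" by (simp add: of_rat_mult of_rat_power)
  then have "\<bar>real_of_int m\<bar> = real p ^ e * \<bar>of_rat x\<bar>" by (metis abs_mult abs_of_nat of_nat_power)
  moreover have "rat_abs p (of_int m) = (1 / real p) ^ e * rat_abs p x"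
    using arg_cong[OF m, of "rat_abs p"] by (simp add: rat_abs_mult rat_abs_power rat_abs_prime)
  ultimately show ?thesis using ge p_gt_1 by (simp add: power_divide field_simps)
qed

end

section \<open>Computing in \<open>\<rat>\<^sub>p\<close> with Cauchy sequences\<close>

context rational_prime
begin

lemma null_iff: "s \<in> null_ideal p \<longleftrightarrow> (\<forall>e>0. \<exists>M. \<forall>n\<ge>M. rat_abs p (s n) < e)"
  by (simp add: null_ideal_def LIMSEQ_iff)

lemma padic_Cauchy_const: "padic_Cauchy p (\<lambda>n. r)"
  by (simp add: padic_Cauchy_def)

lemma padic_Cauchy_add:
  assumes "padic_Cauchy p s" "padic_Cauchy p t"
  shows "padic_Cauchy p (\<lambda>n. s n + t n)"
  unfolding padic_Cauchy_def
proof (intro allI impI)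
  fix e :: real assume "e > 0"
  then obtain M1 M2
    where 1: "\<And>m n. m \<ge> M1 \<Longrightarrow> n \<ge> M1 \<Longrightarrow> rat_abs p (s m - s n) < e"
      and 2: "\<And>m n. m \<ge> M2 \<Longrightarrow> n \<ge> M2 \<Longrightarrow> rat_abs p (t m - t n) < e"
    using assms unfolding padic_Cauchy_def by metis
  have "rat_abs p (s m + t m - (s n + t n)) < e" if "m \<ge> max M1 M2" "n \<ge> max M1 M2" for m n
    using rat_abs_add[of "s m - s n" "t m - t n"] 1[of m n] 2[of m n] that
    by (simp add: algebra_simps)
  then show "\<exists>M. \<forall>m\<ge>M. \<forall>n\<ge>M. rat_abs p (s m + t m - (s n + t n)) < e" by blast
qed

lemma padic_Cauchy_minus:
  assumes "padic_Cauchy p s"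
  shows "padic_Cauchy p (\<lambda>n. - s n)"
proof -
  have "rat_abs p (- s m - - s n) = rat_abs p (s m - s n)" for m n
    using rat_abs_minus[of "s m - s n"] by (simp del: rat_abs_minus add: algebra_simps)
  with assms show ?thesis unfolding padic_Cauchy_def by presburger
qed

lemma padic_Cauchy_diff:
  "padic_Cauchy p s \<Longrightarrow> padic_Cauchy p t \<Longrightarrow> padic_Cauchy p (\<lambda>n. s n - t n)"
  using padic_Cauchy_add[OF _ padic_Cauchy_minus, of s t] by simp

lemma padic_Cauchy_bounded:
  assumes "padic_Cauchy p s"
  obtains C where "C > 0" "\<And>n. rat_abs p (s n) \<le> C"
proof -
  obtain M where M: "\<And>m n. m \<ge> M \<Longrightarrow> n \<ge> M \<Longrightarrow> rat_abs p (s m - s n) < 1"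
    using assms unfolding padic_Cauchy_def by (meson zero_less_one)
  define C where "C = Max ((\<lambda>n. rat_abs p (s n)) ` {..M}) + 1"
  have C: "rat_abs p (s n) + 1 \<le> C" if "n \<le> M" for n
    unfolding C_def using that by (intro add_right_mono Max_ge) auto
  have "C > 0" using C[of 0] rat_abs_nonneg[of "s 0"] by linarith
  moreover have "rat_abs p (s n) \<le> C" for n
  proof (cases "n \<le> M")
    case True
    then show ?thesis using C[of n] by simp
  next
    case False
    then have "rat_abs p (s n - s M) < 1" by (intro M) auto
    then show ?thesis using rat_abs_add[of "s n - s M" "s M"] C[OF order_refl]
        rat_abs_nonneg[of "s M"] unfolding diff_add_cancel by linarith
  qed
  ultimately show thesis by (rule that)
qed

lemma null_mult:
  assumes s: "s \<in> null_ideal p" and t: "padic_Cauchy p t"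
  shows "(\<lambda>n. t n * s n) \<in> null_ideal p"
  unfolding null_iff
proof (intro allI impI)
  fix e :: real assume e: "e > 0"
  obtain C where C: "C > 0" "\<And>n. rat_abs p (t n) \<le> C" using padic_Cauchy_bounded[OF t] by blast
  obtain M where M: "\<And>n. n \<ge> M \<Longrightarrow> rat_abs p (s n) < e / C"
    using s e C(1) unfolding null_iff by (meson divide_pos_pos)
  have "rat_abs p (t n * s n) < e" if "n \<ge> M" for n
  proof -
    have "rat_abs p (t n * s n) \<le> C * rat_abs p (s n)"
      unfolding rat_abs_mult by (intro mult_right_mono C) simp
    also have "\<dots> < C * (e / C)" using C M[OF that] by (intro mult_strict_left_mono) auto
    finally show ?thesis using C by simp
  qed
  then show "\<exists>M. \<forall>n\<ge>M. rat_abs p (t n * s n) < e" by blast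
qed

lemma padic_Cauchy_mult:
  assumes s: "padic_Cauchy p s" and t: "padic_Cauchy p t"
  shows "padic_Cauchy p (\<lambda>n. s n * t n)"
  unfolding padic_Cauchy_def
proof (intro allI impI)
  fix e :: real assume e: "e > 0"
  obtain C where C: "C > 0" "\<And>n. rat_abs p (s n) \<le> C" using padic_Cauchy_bounded[OF s] by blast
  obtain E where E: "E > 0" "\<And>n. rat_abs p (t n) \<le> E" using padic_Cauchy_bounded[OF t] by blast
  obtain M1 where M1: "\<And>m n. m \<ge> M1 \<Longrightarrow> n \<ge> M1 \<Longrightarrow> rat_abs p (s m - s n) < e / E"
    using s e E(1) unfolding padic_Cauchy_def by (meson divide_pos_pos)
  obtain M2 where M2: "\<And>m n. m \<ge> M2 \<Longrightarrow> n \<ge> M2 \<Longrightarrow> rat_abs p (t m - t n) < e / C"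
    using t e C(1) unfolding padic_Cauchy_def by (meson divide_pos_pos)
  have "rat_abs p (s m * t m - s n * t n) < e" if "m \<ge> max M1 M2" "n \<ge> max M1 M2" for m n
  proof -
    have "rat_abs p ((s m - s n) * t m) \<le> rat_abs p (s m - s n) * E"
      unfolding rat_abs_mult by (intro mult_left_mono E) simp
    also have "\<dots> < e / E * E" using E M1[of m n] that by (intro mult_strict_right_mono) auto
    finally have 1: "rat_abs p ((s m - s n) * t m) < e" using E by simp
    have "rat_abs p (s n * (t m - t n)) \<le> C * rat_abs p (t m - t n)"
      unfolding rat_abs_mult by (intro mult_right_mono C) simp
    also have "\<dots> < C * (e / C)" using C M2[of m n] that by (intro mult_strict_left_mono) auto
    finally have 2: "rat_abs p (s n * (t m - t n)) < e" using C by simp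
    have "s m * t m - s n * t n = (s m - s n) * t m + s n * (t m - t n)" by (simp add: algebra_simps)
    then show ?thesis using rat_abs_add[of "(s m - s n) * t m" "s n * (t m - t n)"] 1 2 by simp
  qed
  then show "\<exists>M. \<forall>m\<ge>M. \<forall>n\<ge>M. rat_abs p (s m * t m - s n * t n) < e" by blast
qed

lemma null_imp_padic_Cauchy:
  assumes "s \<in> null_ideal p"
  shows "padic_Cauchy p s"
  unfolding padic_Cauchy_def
proof (intro allI impI)
  fix e :: real assume "e > 0"
  then obtain M where M: "\<And>n. n \<ge> M \<Longrightarrow> rat_abs p (s n) < e"
    using assms unfolding null_iff by metis
  have "rat_abs p (s m - s n) < e" if "m \<ge> M" "n \<ge> M" for m n
    using rat_abs_diff[of "s m" "s n"] M[of m] M[of n] that by simp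
  then show "\<exists>M. \<forall>m\<ge>M. \<forall>n\<ge>M. rat_abs p (s m - s n) < e" by blast
qed

lemma null_add:
  assumes "s \<in> null_ideal p" "t \<in> null_ideal p"
  shows "(\<lambda>n. s n + t n) \<in> null_ideal p"
  unfolding null_iff
proof (intro allI impI)
  fix e :: real assume "e > 0"
  then obtain M1 M2 where M: "\<And>n. n \<ge> M1 \<Longrightarrow> rat_abs p (s n) < e" "\<And>n. n \<ge> M2 \<Longrightarrow> rat_abs p (t n) < e"
    using assms unfolding null_iff by metis
  have "rat_abs p (s n + t n) < e" if "n \<ge> max M1 M2" for n
    using rat_abs_add[of "s n" "t n"] M(1)[of n] M(2)[of n] that by simp
  then show "\<exists>M. \<forall>n\<ge>M. rat_abs p (s n + t n) < e" by blast
qed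

lemma null_0: "(\<lambda>n. 0) \<in> null_ideal p"
  by (simp add: null_iff)

lemma null_minus_iff: "(\<lambda>n. - s n) \<in> null_ideal p \<longleftrightarrow> s \<in> null_ideal p"
  by (simp add: null_ideal_def)

lemma Cauchy_ring_simps:
  "carrier (Cauchy_ring p) = {s. padic_Cauchy p s}"
  "s \<otimes>\<^bsub>Cauchy_ring p\<^esub> t = (\<lambda>n. s n * t n)"
  "s \<oplus>\<^bsub>Cauchy_ring p\<^esub> t = (\<lambda>n. s n + t n)"
  "\<one>\<^bsub>Cauchy_ring p\<^esub> = (\<lambda>n. 1)"
  "\<zero>\<^bsub>Cauchy_ring p\<^esub> = (\<lambda>n. 0)"
  by (simp_all add: Cauchy_ring_def)

lemma Cauchy_ring_cring: "cring (Cauchy_ring p)"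
proof (rule cringI)
  show "abelian_group (Cauchy_ring p)"
    by (rule abelian_groupI)
      (auto simp: Cauchy_ring_simps padic_Cauchy_const padic_Cauchy_add algebra_simps
        intro!: bexI[where x = "\<lambda>n. - s n" for s] padic_Cauchy_minus)
  show "Group.comm_monoid (Cauchy_ring p)"
    by (rule comm_monoidI)
      (auto simp: Cauchy_ring_simps padic_Cauchy_const padic_Cauchy_mult algebra_simps)
qed (auto simp: Cauchy_ring_simps algebra_simps)

lemma Cauchy_ring_minus:
  assumes "padic_Cauchy p s"
  shows "\<ominus>\<^bsub>Cauchy_ring p\<^esub> s = (\<lambda>n. - s n)"
proof -
  interpret cring "Cauchy_ring p" by (rule Cauchy_ring_cring)
  show ?thesis using assms
    by (intro minus_equality) (auto simp: Cauchy_ring_simps padic_Cauchy_minus)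
qed

lemma null_ideal_ideal: "ideal (null_ideal p) (Cauchy_ring p)"
proof -
  interpret cring "Cauchy_ring p" by (rule Cauchy_ring_cring)
  show ?thesis
  proof (rule idealI)
    show "subgroup (null_ideal p) (add_monoid (Cauchy_ring p))"
    proof (rule add.subgroupI)
      show "null_ideal p \<subseteq> carrier (Cauchy_ring p)" "null_ideal p \<noteq> {}"
        using null_imp_padic_Cauchy null_0 by (auto simp: Cauchy_ring_simps)
      show "\<ominus>\<^bsub>Cauchy_ring p\<^esub> s \<in> null_ideal p" if "s \<in> null_ideal p" for s
        using that by (simp add: Cauchy_ring_minus null_imp_padic_Cauchy null_minus_iff)
      show "s \<oplus>\<^bsub>Cauchy_ring p\<^esub> t \<in> null_ideal p" if "s \<in> null_ideal p" "t \<in> null_ideal p" for s t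
        using that by (simp add: Cauchy_ring_simps null_add)
    qed
    show "x \<otimes>\<^bsub>Cauchy_ring p\<^esub> s \<in> null_ideal p"  "s \<otimes>\<^bsub>Cauchy_ring p\<^esub> x \<in> null_ideal p"
      if "s \<in> null_ideal p" "x \<in> carrier (Cauchy_ring p)" for s x
      using null_mult[of s x] that by (auto simp: Cauchy_ring_simps mult.commute)
  qed (rule ring_axioms)
qed

definition Qp_class :: "(nat \<Rightarrow> rat) \<Rightarrow> (nat \<Rightarrow> rat) set" where
  "Qp_class s = null_ideal p +>\<^bsub>Cauchy_ring p\<^esub> s"

lemma rat_to_Qp_class: "rat_to_Qp p r = Qp_class (\<lambda>n. r)"
  by (simp add: rat_to_Qp_def Qp_class_def)

lemma Qp_cring: "cring (Qp p)"
  unfolding Qp_def by (rule ideal.quotient_is_cring[OF null_ideal_ideal Cauchy_ring_cring])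

lemma Qp_class_hom: "ring_hom_cring (Cauchy_ring p) (Qp p) Qp_class"
  using ideal.rcos_ring_hom_cring[OF null_ideal_ideal Cauchy_ring_cring]
  unfolding Qp_def Qp_class_def[abs_def] .

lemma Qp_class_minus:
  assumes "padic_Cauchy p s"
  shows "\<ominus>\<^bsub>Qp p\<^esub> Qp_class s = Qp_class (\<lambda>n. - s n)"
proof -
  interpret h: ring_hom_cring "Cauchy_ring p" "Qp p" Qp_class by (rule Qp_class_hom)
  show ?thesis
    using assms h.hom_a_inv[of s] by (simp add: Cauchy_ring_simps Cauchy_ring_minus)
qed

lemma Qp_class_simps:
  assumes "padic_Cauchy p s" "padic_Cauchy p t"
  shows "Qp_class s \<oplus>\<^bsub>Qp p\<^esub> Qp_class t = Qp_class (\<lambda>n. s n + t n)"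
    and "Qp_class s \<otimes>\<^bsub>Qp p\<^esub> Qp_class t = Qp_class (\<lambda>n. s n * t n)"
    and "Qp_class s \<ominus>\<^bsub>Qp p\<^esub> Qp_class t = Qp_class (\<lambda>n. s n - t n)"
proof -
  interpret h: ring_hom_cring "Cauchy_ring p" "Qp p" Qp_class by (rule Qp_class_hom)
  have add: "Qp_class s \<oplus>\<^bsub>Qp p\<^esub> Qp_class t = Qp_class (\<lambda>n. s n + t n)"
    if "padic_Cauchy p t" for t
    using assms that h.hom_add[of s t] by (simp add: Cauchy_ring_simps)
  show "Qp_class s \<oplus>\<^bsub>Qp p\<^esub> Qp_class t = Qp_class (\<lambda>n. s n + t n)"
    "Qp_class s \<otimes>\<^bsub>Qp p\<^esub> Qp_class t = Qp_class (\<lambda>n. s n * t n)"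
    using assms add h.hom_mult[of s t] by (simp_all add: Cauchy_ring_simps)
  show "Qp_class s \<ominus>\<^bsub>Qp p\<^esub> Qp_class t = Qp_class (\<lambda>n. s n - t n)"
    using assms by (simp add: a_minus_def Qp_class_minus add padic_Cauchy_minus)
qed

lemma Qp_zero: "\<zero>\<^bsub>Qp p\<^esub> = Qp_class (\<lambda>n. 0)"
proof -
  interpret h: ring_hom_cring "Cauchy_ring p" "Qp p" Qp_class by (rule Qp_class_hom)
  show ?thesis using h.hom_zero by (simp add: Cauchy_ring_simps)
qed

lemma carrier_Qp: "carrier (Qp p) = Qp_class ` {s. padic_Cauchy p s}"
  by (auto simp: Qp_def FactRing_def A_RCOSETS_def' Qp_class_def Cauchy_ring_simps)

lemma Qp_class_closed [simp]: "padic_Cauchy p s \<Longrightarrow> Qp_class s \<in> carrier (Qp p)"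
  by (simp add: carrier_Qp)

text \<open>Elements of \<open>\<rat>\<^sub>p\<close> are literally sets of sequences, and \<open>Qp_abs\<close> quantifies over the members of such
  a set, so membership has to be made explicit.\<close>

lemma mem_Qp_class_iff:
  assumes "padic_Cauchy p s"
  shows "t \<in> Qp_class s \<longleftrightarrow> padic_Cauchy p t \<and> (\<lambda>n. t n - s n) \<in> null_ideal p"
proof -
  interpret ideal "null_ideal p" "Cauchy_ring p" by (rule null_ideal_ideal)
  have "padic_Cauchy p t" if "t \<in> Qp_class s"
    using that assms null_imp_padic_Cauchy
    by (auto simp: Qp_class_def a_r_coset_def' Cauchy_ring_simps padic_Cauchy_add)
  moreover have "t \<in> Qp_class s \<longleftrightarrow> (\<lambda>n. t n - s n) \<in> null_ideal p" if "padic_Cauchy p t"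
    using a_rcos_module_minus[OF ring_axioms, of s t] that assms
    by (simp add: Qp_class_def Cauchy_ring_simps a_minus_def Cauchy_ring_minus)
  ultimately show ?thesis by blast
qed

lemma Qp_class_eq_iff:
  assumes "padic_Cauchy p s" "padic_Cauchy p t"
  shows "Qp_class s = Qp_class t \<longleftrightarrow> (\<lambda>n. s n - t n) \<in> null_ideal p"
proof
  assume "Qp_class s = Qp_class t"
  moreover have "s \<in> Qp_class s" using assms by (simp add: mem_Qp_class_iff null_0)
  ultimately show "(\<lambda>n. s n - t n) \<in> null_ideal p" using assms by (simp add: mem_Qp_class_iff)
next
  assume st: "(\<lambda>n. s n - t n) \<in> null_ideal p"
  then have ts: "(\<lambda>n. t n - s n) \<in> null_ideal p"
    using null_minus_iff[of "\<lambda>n. s n - t n"] by simp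
  show "Qp_class s = Qp_class t"
    using null_add[OF _ st] null_add[OF _ ts] assms by (fastforce simp: mem_Qp_class_iff)
qed

text \<open>The definition of \<open>Qp_abs\<close> asks for a common limit of all representatives; it exists because
  the absolute values along a Cauchy sequence form a Cauchy sequence of reals, and null
  sequences do not change their limit.\<close>

lemma Qp_abs_class:
  assumes "padic_Cauchy p s"
  shows "(\<lambda>n. rat_abs p (s n)) \<longlonglongrightarrow> Qp_abs p (Qp_class s)"
proof -
  have tri: "\<bar>rat_abs p x - rat_abs p y\<bar> \<le> rat_abs p (x - y)" for x y
  proof -
    have "rat_abs p x \<le> rat_abs p (x - y) + rat_abs p y" for x y
      using rat_abs_add[of "x - y" y] by (auto intro: order_trans)
    from this[of x y] this[of y x] show ?thesis using rat_abs_minus_commute[of x y] by linarith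
  qed
  have "Cauchy (\<lambda>n. rat_abs p (s n))"
    unfolding Cauchy_def dist_real_def
    using assms tri unfolding padic_Cauchy_def by (meson le_less_trans)
  then obtain L where L: "(\<lambda>n. rat_abs p (s n)) \<longlonglongrightarrow> L"
    using real_Cauchy_convergent convergent_def by blast
  have "(\<lambda>n. rat_abs p (t n)) \<longlonglongrightarrow> L" if "t \<in> Qp_class s" for t
  proof -
    have "(\<lambda>n. rat_abs p (t n - s n)) \<longlonglongrightarrow> 0"
      using that assms by (simp add: mem_Qp_class_iff null_ideal_def)
    then have "(\<lambda>n. rat_abs p (t n) - rat_abs p (s n)) \<longlonglongrightarrow> 0"
      by (rule Lim_null_comparison[rotated]) (auto simp: tri)
    from tendsto_add[OF this L] show ?thesis by simp
  qed
  moreover have "s \<in> Qp_class s" using assms by (simp add: mem_Qp_class_iff null_0)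
  ultimately have "Qp_abs p (Qp_class s) = L"
    unfolding Qp_abs_def using LIMSEQ_unique[OF L] by (intro the_equality) auto
  with L show ?thesis by simp
qed

text \<open>The absolute value takes no values strictly between \<open>1\<close> and \<open>p\<close>, so a representative of a
  \<open>p\<close>-adic integer is integral from some index on, and can be altered before it.\<close>

lemma Zp_representative:
  assumes "z \<in> Zp p"
  obtains s where "padic_Cauchy p s" "z = Qp_class s" "\<And>n. rat_abs p (s n) \<le> 1"
proof -
  obtain s where s: "padic_Cauchy p s" "z = Qp_class s" and le: "Qp_abs p z \<le> 1"
    using assms by (auto simp: Zp_def carrier_Qp)
  have "\<forall>\<^sub>F n in sequentially. rat_abs p (s n) < real p"
    using Qp_abs_class[OF s(1)] le s(2) p_gt_1 by (intro order_tendstoD(2)) auto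
  then obtain M where M: "\<And>n. n \<ge> M \<Longrightarrow> rat_abs p (s n) \<le> 1"
    using rat_abs_less_prime unfolding eventually_sequentially by blast
  define s' where "s' = (\<lambda>n. if n \<ge> M then s n else 0)"
  have null: "(\<lambda>n. s n - s' n) \<in> null_ideal p"
    unfolding null_iff s'_def by (auto intro!: exI[of _ M])
  have s': "padic_Cauchy p s'"
    using padic_Cauchy_diff[OF s(1) null_imp_padic_Cauchy[OF null]] by simp
  show thesis
  proof
    show "z = Qp_class s'" using null s s' by (simp add: Qp_class_eq_iff)
    show "rat_abs p (s' n) \<le> 1" for n using M by (simp add: s'_def)
  qed (rule s')
qed

end

section \<open>Reduced norms and the anisotropy of the norm form\<close>

locale division_quaternion_algebra = quaternion_algebra scl c d i j
  for scl :: "rat \<Rightarrow> 'b::division_ring \<Rightarrow> 'b" and c d :: rat and i j :: 'b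
begin

abbreviation "crd \<equiv> coords scl i j"
abbreviation "norm_form \<equiv> nrd scl c d i j"

definition quat :: "rat quad \<Rightarrow> 'b" where
  "quat = (\<lambda>(t, u, v, w). scl t 1 + scl u i + scl v j + scl w (i * j))"

lemma coords_quat: "crd (quat q) = q"
proof -
  obtain t u v w where q: "q = (t, u, v, w)" by (cases q)
  let ?A = "{1, i, j, i * j}"
  have rep: "representation ?A (quat q) b =
      t * representation ?A 1 b + u * representation ?A i b
      + v * representation ?A j b + w * representation ?A (i * j) b" for b
    by (simp add: quat_def q representation_add representation_scale independent_basis span_basis)
  have basis: "representation ?A a = (\<lambda>b. if b = a then 1 else 0)" if "a \<in> ?A" for a
    using representation_basis[OF independent_basis that] .
  show ?thesis
    using distinct_basis unfolding coords_def Let_def rep by (auto simp: basis q)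
qed

lemma quat_coords: "quat (crd x) = x"
proof -
  have "(\<Sum>b\<in>{1, i, j, i * j}. scl (representation {1, i, j, i * j} x b) b) = x"
    using sum_representation_eq[OF independent_basis, of x "{1, i, j, i * j}"] span_basis by auto
  then show ?thesis using distinct_basis by (simp add: quat_def coords_def Let_def add.assoc)
qed

lemma quat_cases:
  obtains t u v w where "x = quat (t, u, v, w)"
  by (metis quat_coords surj_pair)

lemma quat_add: "quat (t, u, v, w) + quat (t', u', v', w') = quat (t + t', u + u', v + v', w + w')"
  by (simp add: quat_def scale_left_distrib)

lemma quat_scale: "scl r (quat (t, u, v, w)) = quat (r * t, r * u, r * v, r * w)"
  by (simp add: quat_def scale_right_distrib)

lemma quat_minus: "- quat (t, u, v, w) = quat (- t, - u, - v, - w)"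
  by (simp add: quat_def)

lemma quat_0: "quat (0, 0, 0, 0) = 0"
  by (simp add: quat_def)

lemma quat_1: "quat (1, 0, 0, 0) = 1"
  by (simp add: quat_def)

lemma basis_products:
  "i * (i * j) = scl c j" "j * (i * j) = - scl d i" "(i * j) * i = - scl c j"
  "(i * j) * j = scl d i" "(i * j) * (i * j) = - scl (c * d) 1"
proof -
  show 1: "i * (i * j) = scl c j"
    by (simp add: i_square scale_mult_left flip: mult.assoc)
  show 4: "(i * j) * j = scl d i"
    by (simp add: j_square scale_mult_right mult.assoc)
  have "j * (i * j) = (j * i) * j" by (simp add: mult.assoc)
  then show 2: "j * (i * j) = - scl d i"
    unfolding anticommute using 4 by simp
  have "(i * j) * i = i * (j * i)" by (simp add: mult.assoc)
  then show "(i * j) * i = - scl c j"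
    unfolding anticommute using 1 by simp
  have "(i * j) * (i * j) = i * (j * (i * j))" by (simp add: mult.assoc)
  also have "\<dots> = - scl (c * d) 1"
    unfolding 2 by (simp add: scale_mult_right i_square mult.commute)
  finally show "(i * j) * (i * j) = - scl (c * d) 1" .
qed

lemma quat_mult:
  "quat (t, u, v, w) * quat (t', u', v', w') =
     quat (t * t' + c * (u * u') + d * (v * v') - c * d * (w * w'),
           t * u' + u * t' + d * (w * v' - v * w'),
           t * v' + v * t' + c * (u * w' - w * u'),
           t * w' + w * t' + (u * v' - v * u'))"
proof -
  have eq: "scl a x * scl b y = scl (a * b) (x * y)" for a b x y
    by (simp add: scale_mult_left scale_mult_right)
  show ?thesis
    unfolding quat_def split_conv distrib_left distrib_right eq mult_1_left mult_1_right
      i_square j_square anticommute basis_products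
    by (simp add: scale_left_distrib scale_left_diff_distrib algebra_simps)
qed

lemma nrd_quat: "norm_form (quat (t, u, v, w)) = t\<^sup>2 - c * u\<^sup>2 - d * v\<^sup>2 + c * d * w\<^sup>2"
  by (simp add: nrd_def coords_quat)

lemma nrd_mult: "norm_form (x * y) = norm_form x * norm_form y"
proof -
  obtain t u v w where x: "x = quat (t, u, v, w)" by (rule quat_cases)
  obtain t' u' v' w' where y: "y = quat (t', u', v', w')" by (rule quat_cases)
  show ?thesis unfolding x y quat_mult nrd_quat by (simp add: power2_eq_square algebra_simps)
qed

lemma nrd_0 [simp]: "norm_form 0 = 0"
  using nrd_quat[of 0 0 0 0] by (simp add: quat_0)

lemma nrd_1 [simp]: "norm_form 1 = 1"
  using nrd_quat[of 1 0 0 0] by (simp add: quat_1)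

text \<open>In a division algebra the multiplicative form \<open>nrd\<close> takes inverses to inverses, so it is
  anisotropic.\<close>

lemma nrd_eq_0_iff [simp]: "norm_form x = 0 \<longleftrightarrow> x = 0"
proof
  assume 0: "norm_form x = 0"
  show "x = 0"
  proof (rule ccontr)
    assume "x \<noteq> 0"
    then have "norm_form x * norm_form (inverse x) = 1" by (simp flip: nrd_mult)
    with 0 show False by simp
  qed
qed simp

lemma nrd_power: "norm_form (x ^ k) = norm_form x ^ k"
  by (induction k) (simp_all add: nrd_mult)

lemma nrd_scale: "norm_form (scl r x) = r\<^sup>2 * norm_form x"
  by (cases x rule: quat_cases) (simp add: quat_scale nrd_quat algebra_simps power2_eq_square)

lemma nrd_minus: "norm_form (- x) = norm_form x"
  by (cases x rule: quat_cases) (simp add: quat_minus nrd_quat)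

end

lemma is_division_no_zero_divisors:
  assumes D: "is_division D" and x: "x \<in> carrier D" "x \<noteq> \<zero>\<^bsub>D\<^esub>"
    and y: "y \<in> carrier D" and xy: "x \<otimes>\<^bsub>D\<^esub> y = \<zero>\<^bsub>D\<^esub>"
  shows "y = \<zero>\<^bsub>D\<^esub>"
proof -
  interpret ring D using D by (simp add: is_division_def)
  have "x \<in> Units D" using D x by (simp add: is_division_def)
  then obtain z where z: "z \<in> carrier D" "z \<otimes>\<^bsub>D\<^esub> x = \<one>\<^bsub>D\<^esub>" by (auto simp: Units_def)
  have "y = (z \<otimes>\<^bsub>D\<^esub> x) \<otimes>\<^bsub>D\<^esub> y" using z y by simp
  also have "\<dots> = z \<otimes>\<^bsub>D\<^esub> (x \<otimes>\<^bsub>D\<^esub> y)" using m_assoc[of z x y] x y z by simp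
  finally show ?thesis using z xy by simp
qed

context rational_prime
begin

lemmas padic_Cauchy_intros =
  padic_Cauchy_const padic_Cauchy_add padic_Cauchy_diff padic_Cauchy_mult padic_Cauchy_minus

text \<open>Over \<open>\<rat>\<^sub>p\<close>, the norm of a quaternion is its product with its conjugate. If it vanishes in a
  division algebra, then one of the two factors is zero, and both have the scalar part \<open>t\<close>.
  In terms of rational sequences, vanishing means tending to zero.\<close>

lemma norm_form_anisotropic:
  assumes ram: "ramified_at c d p"
    and C: "padic_Cauchy p t" "padic_Cauchy p u" "padic_Cauchy p v" "padic_Cauchy p w"
    and null: "(\<lambda>n. (t n)\<^sup>2 - c * (u n)\<^sup>2 - d * (v n)\<^sup>2 + c * d * (w n)\<^sup>2) \<in> null_ideal p"
  shows "t \<in> null_ideal p"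
proof (rule ccontr)
  assume t: "t \<notin> null_ideal p"
  let ?D = "quat_Qp c d p"
  let ?X = "(Qp_class t, Qp_class u, Qp_class v, Qp_class w)"
  let ?Y = "(Qp_class t, Qp_class (\<lambda>n. - u n), Qp_class (\<lambda>n. - v n), Qp_class (\<lambda>n. - w n))"
  have zero: "\<zero>\<^bsub>?D\<^esub> = (Qp_class (\<lambda>n. 0), Qp_class (\<lambda>n. 0), Qp_class (\<lambda>n. 0), Qp_class (\<lambda>n. 0))"
    by (simp add: quat_Qp_def quat_ring_def Qp_zero)
  have t0: "Qp_class t \<noteq> Qp_class (\<lambda>n. 0)"
    using t C by (simp add: Qp_class_eq_iff padic_Cauchy_const)
  have car: "?X \<in> carrier ?D" "?Y \<in> carrier ?D"
    using C by (auto simp: quat_Qp_def quat_ring_def padic_Cauchy_intros)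
  have n: "Qp_class (\<lambda>n. t n * t n - c * (u n * u n) - d * (v n * v n) + c * d * (w n * w n))
      = Qp_class (\<lambda>n. 0)"
    using null C by (subst Qp_class_eq_iff) (auto simp: power2_eq_square intro!: padic_Cauchy_intros)
  have "?X \<otimes>\<^bsub>?D\<^esub> ?Y = \<zero>\<^bsub>?D\<^esub>"
    unfolding quat_Qp_def quat_ring_def rat_to_Qp_class
    using C n by (simp add: Qp_zero Qp_class_simps padic_Cauchy_intros algebra_simps)
  moreover have "?X \<noteq> \<zero>\<^bsub>?D\<^esub>" "?Y \<noteq> \<zero>\<^bsub>?D\<^esub>" using t0 by (simp_all add: zero)
  ultimately show False
    using is_division_no_zero_divisors[OF _ car(1) _ car(2)] ram by (auto simp: ramified_at_def)
qed

text \<open>Hensel's lemma for \<open>T\<^sup>2 - \<tau> T + m\<close> with \<open>|\<tau>| > 1 \<ge> |m|\<close>: solving for the linear term gives the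
  contraction \<open>r \<mapsto> (r\<^sup>2 + m) / \<tau>\<close> of the unit ball, and the value of the polynomial at an
  iterate is a multiple of the next step.\<close>

lemma quadratic_small_root:
  assumes tau: "rat_abs p \<tau> > 1" and m: "rat_abs p m \<le> 1"
  obtains r where "padic_Cauchy p r" "\<And>k. rat_abs p (r k) \<le> 1"
    "(\<lambda>k. (r k)\<^sup>2 - \<tau> * r k + m) \<in> null_ideal p"
proof -
  define r where "r = rec_nat 0 (\<lambda>_ x. (x\<^sup>2 + m) / \<tau>)"
  have r0: "r 0 = 0" and rS: "r (Suc k) = ((r k)\<^sup>2 + m) / \<tau>" for k by (simp_all add: r_def)
  define \<rho> where "\<rho> = inverse (rat_abs p \<tau>)"
  have \<rho>: "0 < \<rho>" "\<rho> < 1" using tau by (simp_all add: \<rho>_def inverse_less_1_iff)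
  have \<tau>0: "\<tau> \<noteq> 0" using tau by auto
  have bound: "rat_abs p (r k) \<le> 1" for k
  proof (induction k)
    case (Suc k)
    have "rat_abs p ((r k)\<^sup>2 + m) \<le> max (rat_abs p ((r k)\<^sup>2)) (rat_abs p m)" by (rule rat_abs_add)
    also have "\<dots> \<le> 1" using Suc m by (simp add: rat_abs_power power_le_one)
    finally have "rat_abs p ((r k)\<^sup>2 + m) \<le> rat_abs p \<tau>" using tau by linarith
    then show ?case using tau by (simp add: rS rat_abs_divide)
  qed (simp add: r0)
  have step: "rat_abs p (r (Suc k) - r k) \<le> \<rho> ^ k" for k
  proof (induction k)
    case 0
    show ?case using rat_abs_diff[of "r 1" "r 0"] bound[of 1] by (simp add: r0)
  next
    case (Suc k)
    have "r (Suc (Suc k)) - r (Suc k) = (r (Suc k) - r k) * (r (Suc k) + r k) / \<tau>"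
      using \<tau>0 unfolding rS[of "Suc k"] rS[of k]
      by (simp add: field_simps power2_eq_square flip: rS)
    then have "rat_abs p (r (Suc (Suc k)) - r (Suc k))
        = rat_abs p (r (Suc k) - r k) * rat_abs p (r (Suc k) + r k) * \<rho>"
      by (simp add: rat_abs_mult rat_abs_inverse \<rho>_def divide_inverse)
    also have "\<dots> \<le> \<rho> ^ k * 1 * \<rho>"
    proof (intro mult_right_mono mult_mono Suc.IH)
      show "rat_abs p (r (Suc k) + r k) \<le> 1"
        using rat_abs_add[of "r (Suc k)" "r k"] bound[of k] bound[of "Suc k"] by linarith
    qed (use \<rho> in auto)
    finally show ?case by (simp add: mult.commute)
  qed
  have far: "rat_abs p (r (k + l) - r k) \<le> \<rho> ^ k" for k l
  proof (induction l)
    case (Suc l)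
    have "rat_abs p (r (Suc (k + l)) - r (k + l)) \<le> \<rho> ^ (k + l)" by (rule step)
    also have "\<dots> \<le> \<rho> ^ k" using \<rho> by (intro power_decreasing) auto
    finally show ?case
      using rat_abs_add[of "r (Suc (k + l)) - r (k + l)" "r (k + l) - r k"] Suc by simp
  qed (use \<rho> in simp)
  have lim: "(\<lambda>k. \<rho> ^ k) \<longlonglongrightarrow> 0" using \<rho> by (intro LIMSEQ_power_zero) auto
  show thesis
  proof
    show "padic_Cauchy p r"
      unfolding padic_Cauchy_def
    proof (intro allI impI)
      fix e :: real assume "e > 0"
      then obtain M where M: "\<rho> ^ M < e"
        using order_tendstoD(2)[OF lim] unfolding eventually_sequentially by blast
      have "rat_abs p (r m - r n) < e" if "m \<ge> M" "n \<ge> M" for m n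
        using far[of M "m - M"] far[of M "n - M"] that M
          rat_abs_diff[of "r m - r M" "r n - r M"] by simp
      then show "\<exists>M. \<forall>m\<ge>M. \<forall>n\<ge>M. rat_abs p (r m - r n) < e" by blast
    qed
    have "(r k)\<^sup>2 - \<tau> * r k + m = \<tau> * (r (Suc k) - r k)" for k
      using \<tau>0 by (simp add: rS field_simps)
    moreover have "(\<lambda>k. r (Suc k) - r k) \<in> null_ideal p"
      unfolding null_ideal_def mem_Collect_eq
      by (rule Lim_null_comparison[OF _ lim]) (simp add: step)
    ultimately show "(\<lambda>k. (r k)\<^sup>2 - \<tau> * r k + m) \<in> null_ideal p"
      using null_mult[OF _ padic_Cauchy_const] by simp
  qed (rule bound)
qed

end

section \<open>The absolute value of a ramified quaternion algebra\<close>

locale ramified_quaternion_algebra =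
  division_quaternion_algebra scl c d i j + rational_prime p
  for scl :: "rat \<Rightarrow> 'b::division_ring \<Rightarrow> 'b" and c d :: rat and i j :: 'b and p :: nat +
  assumes ramified: "ramified_at c d p"
begin

abbreviation "vabs \<equiv> quat_abs scl c d i j p"

lemma vabs_nonneg [simp]: "vabs x \<ge> 0"
  by (simp add: quat_abs_def)

lemma vabs_0 [simp]: "vabs 0 = 0"
  by (simp add: quat_abs_def)

text \<open>The square of the absolute value is a rational absolute value, which is how the powers of \<open>p\<close>
  with half-integral exponents are avoided below.\<close>

lemma vabs_square: "(vabs x)\<^sup>2 = rat_abs p (norm_form x)"
proof (cases "x = 0")
  case False
  let ?r = "real_of_int (rat_val p (norm_form x))"
  have "(vabs x)\<^sup>2 = real p powr (- ?r / 2 + - ?r / 2)"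
    using False unfolding power2_eq_square by (simp add: quat_abs_def flip: powr_add)
  also have "\<dots> = real p powr real_of_int (- rat_val p (norm_form x))" by simp
  also have "\<dots> = rat_abs p (norm_form x)"
    using False p_gt_1 by (subst powr_real_of_int') (auto simp: rat_abs_def)
  finally show ?thesis .
qed simp

lemma vabs_eqI: "y \<ge> 0 \<Longrightarrow> y\<^sup>2 = rat_abs p (norm_form x) \<Longrightarrow> vabs x = y"
  using vabs_square[of x] by (metis power2_eq_imp_eq vabs_nonneg)

lemma vabs_mult: "vabs (x * y) = vabs x * vabs y"
  by (rule vabs_eqI) (simp_all add: power_mult_distrib vabs_square nrd_mult rat_abs_mult)

lemma vabs_1 [simp]: "vabs 1 = 1"
  by (rule vabs_eqI) simp_all

lemma vabs_minus [simp]: "vabs (- x) = vabs x"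
  by (rule vabs_eqI) (simp_all add: vabs_square nrd_minus)

lemma vabs_eq_0_iff [simp]: "vabs x = 0 \<longleftrightarrow> x = 0"
  using vabs_square[of x] by auto

lemma vabs_inverse: "vabs (inverse x) = inverse (vabs x)"
proof (cases "x = 0")
  case False
  then have "vabs (inverse x) * vabs x = 1" by (simp flip: vabs_mult)
  then show ?thesis by (metis inverse_unique mult.commute)
qed simp

text \<open>An element of integral norm has integral trace. Otherwise its characteristic polynomial
  \<open>T\<^sup>2 - 2 t T + m\<close> has a root in \<open>\<rat>\<^sub>p\<close>, so that subtracting the root gives an
  element of norm zero; in a division algebra the scalar part \<open>t\<close> is then the root itself,
  which is integral.\<close>

lemma trace_integral:
  assumes m: "rat_abs p (norm_form (quat (t, u, v, w))) \<le> 1"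
  shows "rat_abs p (2 * t) \<le> 1"
proof (rule ccontr)
  define m where "m = norm_form (quat (t, u, v, w))"
  assume "\<not> rat_abs p (2 * t) \<le> 1"
  then have tau: "rat_abs p (2 * t) > 1" by simp
  obtain r where r: "padic_Cauchy p r" "\<And>k. rat_abs p (r k) \<le> 1"
      and null: "(\<lambda>k. (r k)\<^sup>2 - 2 * t * r k + m) \<in> null_ideal p"
    using quadratic_small_root[OF tau, of m] m unfolding m_def by blast
  have "(\<lambda>k. (t - r k)\<^sup>2 - c * u\<^sup>2 - d * v\<^sup>2 + c * d * w\<^sup>2) \<in> null_ideal p"
    using null unfolding m_def nrd_quat by (simp add: power2_eq_square algebra_simps)
  then have "(\<lambda>k. t - r k) \<in> null_ideal p"
    using norm_form_anisotropic[OF ramified padic_Cauchy_diff[OF padic_Cauchy_const r(1)]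
        padic_Cauchy_const padic_Cauchy_const padic_Cauchy_const] by blast
  then obtain k where "rat_abs p (t - r k) < 1"
    unfolding null_iff by (metis order_refl zero_less_one)
  then have "rat_abs p t \<le> 1" using rat_abs_add[of "t - r k" "r k"] r(2)[of k] by simp
  moreover have "rat_abs p 2 \<le> 1" using rat_abs_of_int_le_1[of 2] by simp
  ultimately have "rat_abs p (2 * t) \<le> 1" by (simp add: rat_abs_mult mult_le_one)
  with tau show False by simp
qed

text \<open>Since \<open>nrd (1 + z) = 1 + trd z + nrd z\<close>, the integrality of the trace shows that the unit ball is
  stable under \<open>z \<mapsto> 1 + z\<close>; dividing by the larger of two summands gives the ultrametric
  inequality in general.\<close>

lemma vabs_add: "vabs (x + y) \<le> max (vabs x) (vabs y)"
proof -
  have one: "vabs (1 + z) \<le> 1" if "vabs z \<le> 1" for z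
  proof -
    obtain t u v w where z: "z = quat (t, u, v, w)" by (rule quat_cases)
    have m: "rat_abs p (norm_form z) \<le> 1"
      using that by (simp add: power_le_one flip: vabs_square)
    have "norm_form (1 + z) = (1 + 2 * t) + norm_form z"
      unfolding z quat_1[symmetric] quat_add nrd_quat by (simp add: power2_eq_square algebra_simps)
    moreover have "rat_abs p (1 + 2 * t) \<le> 1"
      using rat_abs_add[of 1 "2 * t"] trace_integral[of t u v w] m z by simp
    ultimately have "rat_abs p (norm_form (1 + z)) \<le> 1"
      using rat_abs_add[of "1 + 2 * t" "norm_form z"] m by simp
    then show ?thesis by (simp add: power_le_one_iff flip: vabs_square)
  qed
  have main: "vabs (u + v) \<le> vabs u" if "vabs v \<le> vabs u" for u v
  proof (cases "u = 0")
    case True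
    with that show ?thesis using vabs_nonneg[of v] by (simp add: order_antisym)
  next
    case False
    then have pos: "vabs u > 0" by (simp add: order_less_le)
    have "vabs (inverse u * v) = vabs v / vabs u"
      by (simp add: vabs_mult vabs_inverse divide_inverse mult.commute)
    then have "vabs (inverse u * v) \<le> 1" using that pos by simp
    then have "vabs u * vabs (1 + inverse u * v) \<le> vabs u * 1" by (intro mult_left_mono one) auto
    moreover have "u * (1 + inverse u * v) = u + v"
      using False by (simp add: distrib_left flip: mult.assoc)
    ultimately show ?thesis by (simp flip: vabs_mult)
  qed
  show ?thesis using main[of x y] main[of y x] by (cases "vabs y \<le> vabs x") (auto simp: add.commute)
qed

lemma vabs_add_dominant:
  assumes "vabs y < vabs x"
  shows "vabs (x + y) = vabs x"
proof (rule order_antisym)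
  show "vabs (x + y) \<le> vabs x" using vabs_add[of x y] assms by simp
  show "vabs x \<le> vabs (x + y)" using vabs_add[of "x + y" "- y"] assms by (simp add: max_def split: if_splits)
qed

end

section \<open>Denominators in orders\<close>

context division_quaternion_algebra
begin

lemma scl_of_int: "scl (of_int k) x = of_int k * x"
proof -
  have nat: "scl (of_nat n) y = of_nat n * y" for n and y :: 'b
    by (induction n) (simp_all add: scale_left_distrib distrib_right)
  show ?thesis
    by (cases k rule: int_cases2) (simp_all add: nat)
qed

lemma of_int_mult_commute: "x * (of_int k * y) = of_int k * (x * y)" for x y :: 'b
  unfolding scl_of_int[symmetric] by (rule scale_mult_right)

text \<open>Orders are spans over the integers; this is the module structure in which the spans are taken.\<close>

definition int_scale :: "int \<Rightarrow> 'b \<Rightarrow> 'b" where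
  "int_scale k x = of_int k * x"

sublocale int_module: Modules.module int_scale
  by unfold_locales (simp_all add: int_scale_def algebra_simps)

lemma order_generators:
  assumes "is_order scl R"
  obtains S where "finite S" "R = int_module.span S"
proof -
  have "int_scale = (\<lambda>k x. of_int k * x)" by (simp add: fun_eq_iff int_scale_def)
  with assms that show thesis unfolding is_order_def by auto
qed

lemma order_one: "is_order scl R \<Longrightarrow> 1 \<in> R"
  and order_mult: "is_order scl R \<Longrightarrow> x \<in> R \<Longrightarrow> y \<in> R \<Longrightarrow> x * y \<in> R"
  by (auto simp: is_order_def)

lemma order_add:
  assumes "is_order scl R" "x \<in> R" "y \<in> R"
  shows "x + y \<in> R"
proof -
  obtain S where "R = int_module.span S" using order_generators[OF assms(1)] by blast
  with assms int_module.span_add show ?thesis by simp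
qed

lemma order_of_int_mult:
  assumes "is_order scl R" "x \<in> R"
  shows "of_int k * x \<in> R"
proof -
  obtain S where "R = int_module.span S" using order_generators[OF assms(1)] by blast
  with assms int_module.span_scale[of x S k] show ?thesis by (simp add: int_scale_def)
qed

text \<open>An order spans the algebra over \<open>\<rat>\<close>, so denominators can be cleared.\<close>

lemma order_multiple:
  assumes R: "is_order scl R"
  shows "\<exists>m::int. m > 0 \<and> of_int m * x \<in> R"
proof -
  let ?V = "{x. \<exists>m::int. m > 0 \<and> of_int m * x \<in> R}"
  have "subspace ?V"
  proof (rule subspaceI)
    show "0 \<in> ?V" using order_of_int_mult[OF R order_one[OF R], of 0] by (auto intro: exI[of _ 1])
  next
    fix x y assume "x \<in> ?V" "y \<in> ?V"
    then obtain m n :: int where m: "m > 0" "of_int m * x \<in> R" and n: "n > 0" "of_int n * y \<in> R" by auto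
    have "of_int (m * n) * (x + y) = of_int n * (of_int m * x) + of_int m * (of_int n * y)"
      by (simp add: distrib_left mult.assoc[symmetric] of_int_mult[symmetric] mult.commute[of m n] del: of_int_mult)
    also have "\<dots> \<in> R" by (rule order_add[OF R order_of_int_mult[OF R m(2)] order_of_int_mult[OF R n(2)]])
    finally show "x + y \<in> ?V" using m n by (auto intro!: exI[of _ "m * n"])
  next
    fix r x assume "x \<in> ?V"
    then obtain m :: int where m: "m > 0" "of_int m * x \<in> R" by auto
    obtain a b where q: "quotient_of r = (a, b)" by (cases "quotient_of r")
    have r: "b > 0" "r = of_int a / of_int b"
      using quotient_of_denom_pos[OF q] quotient_of_div[OF q] by auto
    have "of_int (m * b) * scl r x = scl (of_int (m * b)) (scl r x)" by (simp only: scl_of_int)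
    also have "\<dots> = scl (of_int a) (scl (of_int m) x)" using r by (simp add: mult.commute)
    also have "\<dots> = of_int a * (of_int m * x)" by (simp only: scl_of_int)
    also have "\<dots> \<in> R" by (rule order_of_int_mult[OF R m(2)])
    finally show "scl r x \<in> ?V" using m r by (auto intro!: exI[of _ "m * b"])
  qed
  moreover have "R \<subseteq> ?V" by (auto intro: exI[of _ 1])
  ultimately have "span R \<subseteq> ?V" by (rule span_minimal[rotated])
  then show ?thesis using R by (auto simp: is_order_def)
qed

text \<open>The coordinates of the finitely many generators have a common denominator, which then
  bounds the denominators of all reduced norms.\<close>

lemma order_nrd_denominator:
  assumes R: "is_order scl R"
  obtains E :: int where "E > 0" "\<And>x. x \<in> R \<Longrightarrow> of_int E * norm_form x \<in> \<int>"
proof -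
  define P where "P = (\<lambda>(E::int) x. case crd x of (t, u, v, w) \<Rightarrow>
    of_int E * t \<in> \<int> \<and> of_int E * u \<in> \<int> \<and> of_int E * v \<in> \<int> \<and> of_int E * w \<in> \<int>)"
  have P: "P E (quat (t, u, v, w)) \<longleftrightarrow>
    of_int E * t \<in> \<int> \<and> of_int E * u \<in> \<int> \<and> of_int E * v \<in> \<int> \<and> of_int E * w \<in> \<int>" for E t u v w
    by (simp add: P_def coords_quat)
  have den: "\<exists>E::int. E > 0 \<and> of_int E * r \<in> \<int>" for r :: rat
  proof -
    obtain a b where q: "quotient_of r = (a, b)" by (cases "quotient_of r")
    have r: "b > 0" "r = of_int a / of_int b"
      using quotient_of_denom_pos[OF q] quotient_of_div[OF q] by auto
    then show ?thesis by (intro exI[of _ b]) simp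
  qed
  have more: "of_int (E * F) * t \<in> \<int>" if "of_int E * t \<in> \<int>" for E F :: int and t :: rat
    using Ints_mult[OF Ints_of_int[of F] that] by (simp add: mult_ac)
  have one: "\<exists>E>0. P E x" for x
  proof -
    obtain t u v w where x: "x = quat (t, u, v, w)" by (rule quat_cases)
    obtain E1 E2 E3 E4 :: int where E: "E1 > 0" "E2 > 0" "E3 > 0" "E4 > 0"
        "of_int E1 * t \<in> \<int>" "of_int E2 * u \<in> \<int>" "of_int E3 * v \<in> \<int>" "of_int E4 * w \<in> \<int>"
      using den by metis
    have "P (E1 * (E2 * (E3 * E4))) x" unfolding x P
      using more[OF E(5), of "E2 * (E3 * E4)"] more[OF E(6), of "E1 * (E3 * E4)"]
        more[OF E(7), of "E1 * (E2 * E4)"] more[OF E(8), of "E1 * (E2 * E3)"]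
      by (simp add: mult_ac)
    then show ?thesis using E by (intro exI[of _ "E1 * (E2 * (E3 * E4))"]) simp
  qed
  obtain S where S: "finite S" "R = int_module.span S" using order_generators[OF R] by blast
  have "\<exists>E>0. \<forall>x\<in>S. P E x" using S(1)
  proof (induction S)
    case (insert x S)
    then obtain E F where E: "E > 0" "\<forall>x\<in>S. P E x" and F: "F > 0" "P F x" using one[of x] by auto
    have "P (E * F) y" if "y \<in> insert x S" for y
    proof (cases y rule: quat_cases)
      case (1 t u v w)
      from that have "P E y \<or> P F y" using E F by auto
      then show ?thesis using more[of E _ F] more[of F _ E] unfolding 1 P mult.commute[of F E] by blast
    qed
    then show ?case using E F by (intro exI[of _ "E * F"]) auto
  qed (auto intro: exI[of _ 1])
  then obtain E where E: "E > 0" "\<And>x. x \<in> S \<Longrightarrow> P E x" by blast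
  have PR: "P E x" if "x \<in> R" for x
  proof -
    have "int_module.subspace {x. P E x}"
    proof (rule int_module.subspaceI)
      show "0 \<in> {x. P E x}" using P[of E 0 0 0 0] by (simp add: quat_0)
    next
      fix x y assume "x \<in> {x. P E x}" "y \<in> {x. P E x}"
      then show "x + y \<in> {x. P E x}"
        by (cases x rule: quat_cases, cases y rule: quat_cases) (auto simp: quat_add P distrib_left)
    next
      fix k x assume "x \<in> {x. P E x}"
      then show "int_scale k x \<in> {x. P E x}"
        by (cases x rule: quat_cases)
          (auto simp: int_scale_def scl_of_int[symmetric] quat_scale P mult.left_commute[of _ "of_int k"])
    qed
    then have "int_module.span S \<subseteq> {x. P E x}" using E by (intro int_module.span_minimal) auto
    with that S show ?thesis by auto
  qed
  obtain f g :: int where f: "f > 0" "of_int f * c \<in> \<int>" and g: "g > 0" "of_int g * d \<in> \<int>"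
    using den by metis
  show thesis
  proof
    show "E\<^sup>2 * f * g > 0" using E f g by simp
    fix x assume "x \<in> R"
    then have "P E x" by (rule PR)
    then obtain t u v w where x: "x = quat (t, u, v, w)"
      and I: "of_int E * t \<in> \<int>" "of_int E * u \<in> \<int>" "of_int E * v \<in> \<int>" "of_int E * w \<in> \<int>"
      by (metis P quat_cases)
    let ?f = "of_int f :: rat" and ?g = "of_int g :: rat" and ?E = "of_int E :: rat"
    have "of_int (E\<^sup>2 * f * g) * norm_form x =
        ?f * ?g * (?E * t)\<^sup>2 - ?g * (?f * c) * (?E * u)\<^sup>2 - ?f * (?g * d) * (?E * v)\<^sup>2
        + (?f * c) * (?g * d) * (?E * w)\<^sup>2"
      unfolding x nrd_quat by (simp add: power2_eq_square algebra_simps)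
    also have "\<dots> \<in> \<int>" using I f g by (auto elim!: Ints_cases)
    finally show "of_int (E\<^sup>2 * f * g) * norm_form x \<in> \<int>" .
  qed
qed

end

section \<open>From local integrality to \<open>R[1/p]\<close>\<close>

lemma quat_ring_a_inv:
  assumes "cring K" and "t \<in> carrier K" "u \<in> carrier K" "v \<in> carrier K" "w \<in> carrier K"
  shows "\<ominus>\<^bsub>quat_ring K a b\<^esub> (t, u, v, w) = (\<ominus>\<^bsub>K\<^esub> t, \<ominus>\<^bsub>K\<^esub> u, \<ominus>\<^bsub>K\<^esub> v, \<ominus>\<^bsub>K\<^esub> w)"
proof -
  interpret K: cring K by fact
  interpret Q: abelian_group "quat_ring K a b"
  proof (rule abelian_groupI)
    fix x assume "x \<in> carrier (quat_ring K a b)"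
    then obtain t u v w where x: "x = (t, u, v, w)"
      and c: "t \<in> carrier K" "u \<in> carrier K" "v \<in> carrier K" "w \<in> carrier K"
      by (auto simp: quat_ring_def)
    then show "\<exists>y\<in>carrier (quat_ring K a b). y \<oplus>\<^bsub>quat_ring K a b\<^esub> x = \<zero>\<^bsub>quat_ring K a b\<^esub>"
      by (intro bexI[of _ "(\<ominus>\<^bsub>K\<^esub> t, \<ominus>\<^bsub>K\<^esub> u, \<ominus>\<^bsub>K\<^esub> v, \<ominus>\<^bsub>K\<^esub> w)"]) (auto simp: quat_ring_def K.l_neg)
  qed (auto simp: quat_ring_def K.a_ac)
  show ?thesis
    using assms by (intro Q.minus_equality) (auto simp: quat_ring_def K.l_neg)
qed

context division_quaternion_algebra
begin

text \<open>The elements of \<open>B\<close> in the localisation of \<open>R\<close> at the prime \<open>q\<close>: a denominator prime to \<open>q\<close>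
  carries them into \<open>R\<close>.\<close>

definition order_at :: "nat \<Rightarrow> 'b set \<Rightarrow> 'b set" where
  "order_at q R = {x. \<exists>m::int. \<not> int q dvd m \<and> of_int m * x \<in> R}"

lemma order_atI: "\<not> int q dvd m \<Longrightarrow> of_int m * x \<in> R \<Longrightarrow> x \<in> order_at q R"
  by (auto simp: order_at_def)

lemma order_at_add:
  assumes q: "Factorial_Ring.prime q" and R: "is_order scl R"
    and "x \<in> order_at q R" "y \<in> order_at q R"
  shows "x + y \<in> order_at q R"
proof -
  obtain m n :: int where m: "\<not> int q dvd m" "of_int m * x \<in> R" and n: "\<not> int q dvd n" "of_int n * y \<in> R"
    using assms by (auto simp: order_at_def)
  show ?thesis
  proof (rule order_atI)
    show "\<not> int q dvd m * n" using m n q by (simp add: prime_dvd_mult_iff)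
    have "of_int (m * n) * (x + y) = of_int n * (of_int m * x) + of_int m * (of_int n * y)"
      by (simp add: distrib_left mult.assoc[symmetric] of_int_mult[symmetric] mult.commute[of m n] del: of_int_mult)
    also have "\<dots> \<in> R"
      by (rule order_add[OF R order_of_int_mult[OF R m(2)] order_of_int_mult[OF R n(2)]])
    finally show "of_int (m * n) * (x + y) \<in> R" .
  qed
qed

lemma order_at_minus:
  assumes R: "is_order scl R" and "x \<in> order_at q R"
  shows "- x \<in> order_at q R"
proof -
  obtain m :: int where m: "\<not> int q dvd m" "of_int m * x \<in> R" using assms by (auto simp: order_at_def)
  then show ?thesis using order_of_int_mult[OF R m(2), of "-1"] by (auto intro: order_atI)
qed

lemma order_at_scale:
  assumes q: "Factorial_Ring.prime q" and R: "is_order scl R" and x: "x \<in> R" and r: "rat_abs q r \<le> 1"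
  shows "scl r x \<in> order_at q R"
proof -
  interpret rational_prime q by unfold_locales (rule q)
  obtain a b where ab: "r = of_int a / of_int b" "\<not> int q dvd b" using p_integral_fraction[OF r] by blast
  then have "b \<noteq> 0" by auto
  have "of_int b * scl r x = scl (of_int b) (scl r x)" by (simp only: scl_of_int)
  also have "\<dots> = scl (of_int a) x" using ab \<open>b \<noteq> 0\<close> by simp
  also have "\<dots> = of_int a * x" by (rule scl_of_int)
  also have "\<dots> \<in> R" by (rule order_of_int_mult[OF R x])
  finally show ?thesis by (rule order_atI[OF ab(2)])
qed

text \<open>Every element of \<open>R \<otimes> \<int>\<^sub>q\<close> is a limit of elements of the localisation of \<open>R\<close> at \<open>q\<close>:
  this holds for the generators \<open>r \<otimes> z\<close>, on approximating the \<open>q\<close>-adic integer \<open>z\<close> by rational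
  numbers, and is inherited by sums.\<close>

lemma local_order_representative:
  assumes q: "Factorial_Ring.prime q" and R: "is_order scl R" and Y: "Y \<in> local_order scl c d i j R q"
  shows "\<exists>t u v w. padic_Cauchy q t \<and> padic_Cauchy q u \<and> padic_Cauchy q v \<and> padic_Cauchy q w \<and>
    Y = (rational_prime.Qp_class q t, rational_prime.Qp_class q u,
         rational_prime.Qp_class q v, rational_prime.Qp_class q w) \<and>
    (\<forall>n. quat (t n, u n, v n, w n) \<in> order_at q R)"
proof -
  interpret rational_prime q by unfold_locales (rule q)
  let ?rep = "\<lambda>Y. \<exists>t u v w. padic_Cauchy q t \<and> padic_Cauchy q u \<and> padic_Cauchy q v \<and> padic_Cauchy q w \<and>
    Y = (Qp_class t, Qp_class u, Qp_class v, Qp_class w) \<and>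
    (\<forall>n. quat (t n, u n, v n, w n) \<in> order_at q R)"
  let ?D = "quat_Qp c d q"
  have gen: "?rep (map_quad (\<lambda>y. z \<otimes>\<^bsub>Qp q\<^esub> y) (to_quat_Qp scl i j q r))" if "z \<in> Zp q" "r \<in> R" for z r
  proof -
    obtain s where s: "padic_Cauchy q s" "z = Qp_class s" "\<And>n. rat_abs q (s n) \<le> 1"
      using Zp_representative[OF \<open>z \<in> Zp q\<close>] by blast
    obtain t u v w where r: "r = quat (t, u, v, w)" by (rule quat_cases)
    have "map_quad (\<lambda>y. z \<otimes>\<^bsub>Qp q\<^esub> y) (to_quat_Qp scl i j q r) =
      (Qp_class (\<lambda>n. s n * t), Qp_class (\<lambda>n. s n * u), Qp_class (\<lambda>n. s n * v), Qp_class (\<lambda>n. s n * w))"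
      using s by (simp add: r to_quat_Qp_def coords_quat map_quad_def rat_to_Qp_class
          Qp_class_simps padic_Cauchy_const)
    moreover have "quat (s n * t, s n * u, s n * v, s n * w) \<in> order_at q R" for n
      using order_at_scale[OF q R \<open>r \<in> R\<close> s(3)[of n]] by (simp add: r quat_scale)
    ultimately show ?thesis using s padic_Cauchy_mult padic_Cauchy_const
      by (intro exI[of _ "\<lambda>n. s n * t"] exI[of _ "\<lambda>n. s n * u"] exI[of _ "\<lambda>n. s n * v"]
          exI[of _ "\<lambda>n. s n * w"]) simp
  qed
  show "?rep Y"
    using Y unfolding local_order_def
  proof (induction Y rule: generate.induct)
    case one
    have "quat (0, 0, 0, 0) \<in> order_at q R"
      using order_at_scale[OF q R order_one[OF R], of 0] by (simp add: quat_0)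
    then show ?case
      by (intro exI[of _ "\<lambda>n. 0"]) (simp add: quat_Qp_def quat_ring_def Qp_zero padic_Cauchy_const)
  next
    case (incl h)
    then show ?case using gen by blast
  next
    case (inv h)
    then have "?rep h" using gen by blast
    then obtain t u v w where C: "padic_Cauchy q t" "padic_Cauchy q u" "padic_Cauchy q v" "padic_Cauchy q w"
      and h: "h = (Qp_class t, Qp_class u, Qp_class v, Qp_class w)"
      and mem: "\<And>n. quat (t n, u n, v n, w n) \<in> order_at q R" by blast
    have "inv\<^bsub>add_monoid ?D\<^esub> h =
      (Qp_class (\<lambda>n. - t n), Qp_class (\<lambda>n. - u n), Qp_class (\<lambda>n. - v n), Qp_class (\<lambda>n. - w n))"
      unfolding a_inv_def[symmetric] h quat_Qp_def
      using C by (subst quat_ring_a_inv) (simp_all add: Qp_cring Qp_class_minus)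
    moreover have "quat (- t n, - u n, - v n, - w n) \<in> order_at q R" for n
      using order_at_minus[OF R mem[of n]] by (simp add: quat_minus)
    ultimately show ?case using C
      by (intro exI[of _ "\<lambda>n. - t n"] exI[of _ "\<lambda>n. - u n"] exI[of _ "\<lambda>n. - v n"]
          exI[of _ "\<lambda>n. - w n"]) (simp add: padic_Cauchy_minus)
  next
    case (eng h1 h2)
    from eng.IH(1) obtain t u v w
      where C: "padic_Cauchy q t" "padic_Cauchy q u" "padic_Cauchy q v" "padic_Cauchy q w"
      and h1: "h1 = (Qp_class t, Qp_class u, Qp_class v, Qp_class w)"
      and mem1: "\<And>n. quat (t n, u n, v n, w n) \<in> order_at q R" by blast
    from eng.IH(2) obtain t' u' v' w'
      where C': "padic_Cauchy q t'" "padic_Cauchy q u'" "padic_Cauchy q v'" "padic_Cauchy q w'"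
      and h2: "h2 = (Qp_class t', Qp_class u', Qp_class v', Qp_class w')"
      and mem2: "\<And>n. quat (t' n, u' n, v' n, w' n) \<in> order_at q R" by blast
    have "h1 \<otimes>\<^bsub>add_monoid ?D\<^esub> h2 =
      (Qp_class (\<lambda>n. t n + t' n), Qp_class (\<lambda>n. u n + u' n),
       Qp_class (\<lambda>n. v n + v' n), Qp_class (\<lambda>n. w n + w' n))"
      using C C' by (simp add: h1 h2 quat_Qp_def quat_ring_def Qp_class_simps)
    moreover have "quat (t n + t' n, u n + u' n, v n + v' n, w n + w' n) \<in> order_at q R" for n
      using order_at_add[OF q R mem1[of n] mem2[of n]] by (simp add: quat_add)
    ultimately show ?case using C C'
      by (intro exI[of _ "\<lambda>n. t n + t' n"] exI[of _ "\<lambda>n. u n + u' n"]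
          exI[of _ "\<lambda>n. v n + v' n"] exI[of _ "\<lambda>n. w n + w' n"]) (simp add: padic_Cauchy_add)
  qed
qed

text \<open>A rational element that is such a limit already lies in the localisation, because the
  localisation contains all quaternions with sufficiently small coordinates.\<close>

lemma local_order_integral:
  assumes q: "Factorial_Ring.prime q" and R: "is_order scl R"
    and x: "to_quat_Qp scl i j q x \<in> local_order scl c d i j R q"
  shows "x \<in> order_at q R"
proof -
  interpret rational_prime q by unfold_locales (rule q)
  obtain t u v w where C: "padic_Cauchy q t" "padic_Cauchy q u" "padic_Cauchy q v" "padic_Cauchy q w"
    and Y: "to_quat_Qp scl i j q x = (Qp_class t, Qp_class u, Qp_class v, Qp_class w)"
    and mem: "\<And>n. quat (t n, u n, v n, w n) \<in> order_at q R"
    using local_order_representative[OF q R x] by blast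
  obtain t0 u0 v0 w0 where x0: "x = quat (t0, u0, v0, w0)" by (rule quat_cases)
  have null: "(\<lambda>n. t0 - t n) \<in> null_ideal q" "(\<lambda>n. u0 - u n) \<in> null_ideal q"
    "(\<lambda>n. v0 - v n) \<in> null_ideal q" "(\<lambda>n. w0 - w n) \<in> null_ideal q"
    using Y C by (simp_all add: x0 to_quat_Qp_def coords_quat map_quad_def rat_to_Qp_class
        Qp_class_eq_iff padic_Cauchy_const)
  have small: "\<forall>\<^sub>F n in sequentially. scl (s n) b \<in> order_at q R" if s: "s \<in> null_ideal q" for s b
  proof -
    obtain m :: int where m: "m > 0" "of_int m * b \<in> R" using order_multiple[OF R] by blast
    have "\<forall>\<^sub>F n in sequentially. rat_abs q (s n) < rat_abs q (of_int m)"
      using s m unfolding null_ideal_def by (intro order_tendstoD(2)) (auto simp: order_less_le)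
    then show ?thesis
    proof eventually_elim
      case (elim n)
      moreover have "0 < rat_abs q (of_int m)" using elim rat_abs_nonneg le_less_trans by blast
      ultimately have "rat_abs q (s n / of_int m) \<le> 1" by (simp add: rat_abs_divide)
      from order_at_scale[OF q R m(2) this] have "scl (s n / of_int m) (scl (of_int m) b) \<in> order_at q R"
        by (simp only: scl_of_int)
      then show ?case using m by simp
    qed
  qed
  have "\<forall>\<^sub>F n in sequentially. scl (t0 - t n) 1 \<in> order_at q R \<and> scl (u0 - u n) i \<in> order_at q R
      \<and> scl (v0 - v n) j \<in> order_at q R \<and> scl (w0 - w n) (i * j) \<in> order_at q R"
    using null by (intro eventually_conj small)
  then obtain n where n: "scl (t0 - t n) 1 \<in> order_at q R" "scl (u0 - u n) i \<in> order_at q R"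
      "scl (v0 - v n) j \<in> order_at q R" "scl (w0 - w n) (i * j) \<in> order_at q R"
    by (auto simp: eventually_sequentially)
  have "quat (t0 - t n, u0 - u n, v0 - v n, w0 - w n) \<in> order_at q R"
    using n unfolding quat_def split_conv by (intro order_at_add[OF q R])
  from order_at_add[OF q R mem[of n] this] show ?thesis by (simp add: x0 quat_add)
qed

text \<open>This is \<open>R[1/p]\<close>, the elements that are integral at every prime but \<open>p\<close>.\<close>

definition order_away :: "nat \<Rightarrow> 'b set \<Rightarrow> 'b set" where
  "order_away p R = {x. \<exists>e::nat. of_int (int p ^ e) * x \<in> R}"

text \<open>The integers \<open>m\<close> with \<open>m x \<in> R\<close> form an ideal, and integrality at \<open>q\<close> says that its
  positive generator is prime to \<open>q\<close>. So the generator is a power of \<open>p\<close>.\<close>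

lemma order_at_all_imp_order_away:
  assumes p: "Factorial_Ring.prime p" and R: "is_order scl R"
    and x: "\<And>q. Factorial_Ring.prime q \<Longrightarrow> q \<noteq> p \<Longrightarrow> x \<in> order_at q R"
  shows "x \<in> order_away p R"
proof -
  define I where "I = (\<lambda>n::nat. n > 0 \<and> of_int (int n) * x \<in> R)"
  obtain m :: int where "m > 0" "of_int m * x \<in> R" using order_multiple[OF R] by blast
  then have "I (nat m)" by (simp add: I_def)
  define g where "g = (LEAST n. I n)"
  have g: "I g" unfolding g_def using \<open>I (nat m)\<close> by (rule LeastI)
  have least: "g \<le> n" if "I n" for n unfolding g_def using that by (rule Least_le)
  have only_p: "q = p" if q: "Factorial_Ring.prime q" "q dvd g" for q
  proof (rule ccontr)
    assume "q \<noteq> p"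
    then obtain m :: int where m: "\<not> int q dvd m" "of_int m * x \<in> R"
      using x q by (auto simp: order_at_def)
    obtain a b where ab: "a * int g + b * m = gcd (int g) m"
      by (metis bezout_int)
    have "I (nat (gcd (int g) m))"
      unfolding I_def
    proof
      have "of_int (gcd (int g) m) * x = of_int a * (of_int (int g) * x) + of_int b * (of_int m * x)"
        by (simp add: ab[symmetric] distrib_right mult.assoc)
      also have "\<dots> \<in> R"
        using g m order_add[OF R order_of_int_mult[OF R] order_of_int_mult[OF R]] by (auto simp: I_def)
      finally show "of_int (int (nat (gcd (int g) m))) * x \<in> R" by simp
    qed (use g in \<open>simp add: I_def\<close>)
    from least[OF this] have "int g \<le> int (nat (gcd (int g) m))" by (simp only: of_nat_le_iff)
    then have "gcd (int g) m \<ge> int g" by simp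
    moreover have "gcd (int g) m \<le> int g" using g by (intro zdvd_imp_le) (auto simp: I_def)
    ultimately have "int g dvd m" by (metis gcd_dvd2 order_antisym)
    with q m show False by (meson dvd_trans int_dvd_int_iff)
  qed
  obtain e where "g = p ^ e"
  proof -
    have "g > 0" using g by (simp add: I_def)
    moreover have "prime_factors g \<subseteq> {p}" using only_p by (auto simp: in_prime_factors_iff)
    ultimately have "g = p ^ multiplicity p g"
    proof -
      have "g = (\<Prod>q\<in>prime_factors g. q ^ multiplicity q g)"
        using \<open>g > 0\<close> by (simp add: prime_factorization_nat)
      also have "\<dots> = (\<Prod>q\<in>{p}. q ^ multiplicity q g)"
        using \<open>prime_factors g \<subseteq> {p}\<close> \<open>g > 0\<close> p
        by (intro prod.mono_neutral_left) (auto simp: in_prime_factors_iff not_dvd_imp_multiplicity_0)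
      finally show ?thesis by simp
    qed
    then show thesis by (rule that)
  qed
  then show ?thesis using g unfolding order_away_def I_def by auto
qed

lemma order_away_subset: "R \<subseteq> order_away p R"
  by (auto simp: order_away_def intro: exI[of _ 0])

lemma order_awayI: "of_int (int p ^ e) * x \<in> R \<Longrightarrow> x \<in> order_away p R"
  by (auto simp: order_away_def)

lemma order_away_add:
  assumes R: "is_order scl R" and "x \<in> order_away p R" "y \<in> order_away p R"
  shows "x + y \<in> order_away p R"
proof -
  obtain e f where e: "of_int (int p ^ e) * x \<in> R" and f: "of_int (int p ^ f) * y \<in> R"
    using assms by (auto simp: order_away_def)
  have "of_int (int p ^ (e + f)) * (x + y) =
      of_int (int p ^ f) * (of_int (int p ^ e) * x) + of_int (int p ^ e) * (of_int (int p ^ f) * y)"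
    by (simp add: distrib_left mult.assoc[symmetric] power_add[symmetric] add.commute[of e f])
  also have "\<dots> \<in> R" by (rule order_add[OF R order_of_int_mult[OF R e] order_of_int_mult[OF R f]])
  finally show ?thesis by (rule order_awayI)
qed

lemma order_away_mult:
  assumes R: "is_order scl R" and "x \<in> order_away p R" "y \<in> order_away p R"
  shows "x * y \<in> order_away p R"
proof -
  obtain e f where e: "of_int (int p ^ e) * x \<in> R" and f: "of_int (int p ^ f) * y \<in> R"
    using assms by (auto simp: order_away_def)
  have "of_int (int p ^ (e + f)) * (x * y) = (of_int (int p ^ e) * x) * (of_int (int p ^ f) * y)"
    unfolding power_add of_int_mult mult.assoc of_int_mult_commute[of x] ..
  also have "\<dots> \<in> R" by (rule order_mult[OF R e f])
  finally show ?thesis by (rule order_awayI)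
qed

lemma order_away_minus:
  assumes R: "is_order scl R" and "x \<in> order_away p R"
  shows "- x \<in> order_away p R"
proof -
  obtain e where e: "of_int (int p ^ e) * x \<in> R" using assms by (auto simp: order_away_def)
  show ?thesis
    using order_of_int_mult[OF R e, of "-1"] by (intro order_awayI[of p e]) simp
qed

end

section \<open>The archimedean norm\<close>

text \<open>All norms on a space of matrices are equivalent; here each entry is a coordinate of the image of
  a standard basis vector. The scalars are kept general so as to cover \<open>\<real>\<close> and \<open>\<complex>\<close> at once.\<close>

lemma norm_matrix_le_onorm:
  obtains K where "K > 0"
    "\<And>A :: 'k::{euclidean_space, real_algebra_1} ^ 'n ^ 'm. norm A \<le> K * onorm (\<lambda>v. A *v v)"
proof -
  define K where "K = 1 + (\<Sum>r\<in>(UNIV :: 'm set). \<Sum>s\<in>(UNIV :: 'n set). norm (axis s 1 :: 'k ^ 'n))"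
  have "norm A \<le> K * onorm (\<lambda>v. A *v v)" for A :: "'k ^ 'n ^ 'm"
  proof -
    let ?N = "onorm (\<lambda>v. A *v v)"
    have entry: "norm (A $ r $ s) \<le> ?N * norm (axis s 1 :: 'k ^ 'n)" for r s
    proof -
      have "A $ r $ s = (A *v axis s 1) $ r"
        by (simp add: matrix_vector_mult_def axis_def if_distrib cong: if_cong)
      also have "norm \<dots> \<le> norm (A *v axis s 1)" by (rule Finite_Cartesian_Product.norm_nth_le)
      also have "\<dots> \<le> ?N * norm (axis s 1 :: 'k ^ 'n)"
        by (rule onorm) (rule matrix_vector_mul_bounded_linear)
      finally show ?thesis .
    qed
    have "norm A \<le> (\<Sum>r\<in>UNIV. norm (A $ r))" unfolding norm_vec_def by (rule L2_set_le_sum) simp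
    also have "\<dots> \<le> (\<Sum>r\<in>UNIV. \<Sum>s\<in>UNIV. norm (A $ r $ s))"
      unfolding norm_vec_def[of "vec_nth A r" for r] by (intro sum_mono L2_set_le_sum) simp
    also have "\<dots> \<le> (\<Sum>r\<in>(UNIV :: 'm set). \<Sum>s\<in>(UNIV :: 'n set). ?N * norm (axis s 1 :: 'k ^ 'n))"
      by (intro sum_mono entry)
    also have "\<dots> = ?N * (K - 1)" by (simp only: K_def add_diff_cancel_left' sum_distrib_left)
    also have "\<dots> \<le> K * ?N"
      using onorm_pos_le[OF matrix_vector_mul_bounded_linear[of A]] by (simp add: algebra_simps)
    finally show ?thesis .
  qed
  moreover have "K > 0" unfolding K_def by (intro add_pos_nonneg sum_nonneg) auto
  ultimately show thesis using that by blast
qed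

lemma ring_of_type_algebra_minus:
  "x \<ominus>\<^bsub>ring_of_type_algebra\<^esub> y = x - (y :: real)"
proof -
  interpret cring "ring_of_type_algebra :: real ring" by (rule cring_from_type_algebra)
  have "\<ominus>\<^bsub>ring_of_type_algebra\<^esub> y = - y"
    by (rule minus_equality) (simp_all add: ring_of_type_algebra_def)
  then show ?thesis by (simp add: a_minus_def) (simp add: ring_of_type_algebra_def)
qed

context division_quaternion_algebra
begin

abbreviation to_real :: "'b \<Rightarrow> real quad" where
  "to_real \<equiv> to_quat_real scl i j"

lemma to_real_quat: "to_real (quat (t, u, v, w)) = (of_rat t, of_rat u, of_rat v, of_rat w)"
  by (simp add: to_quat_real_def coords_quat map_quad_def)

lemma to_real_add: "to_real (x + y) = to_real x + to_real y"
  by (cases x rule: quat_cases; cases y rule: quat_cases) (simp add: quat_add to_real_quat of_rat_add)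

lemma to_real_minus: "to_real (- x) = - to_real x"
  by (cases x rule: quat_cases) (simp add: quat_minus to_real_quat of_rat_minus)

lemma to_real_mult: "to_real (x * y) = to_real x \<otimes>\<^bsub>quat_real c d\<^esub> to_real y"
proof -
  have K: "a \<otimes>\<^bsub>ring_of_type_algebra\<^esub> b = a * b" "a \<oplus>\<^bsub>ring_of_type_algebra\<^esub> b = a + b" for a b :: real
    by (simp_all add: ring_of_type_algebra_def)
  show ?thesis
    by (cases x rule: quat_cases; cases y rule: quat_cases)
      (simp add: quat_mult to_real_quat quat_real_def quat_ring_def K ring_of_type_algebra_minus
        of_rat_add of_rat_mult of_rat_diff)
qed

text \<open>The reduced norm is a quadratic form in the coordinates.\<close>

lemma nrd_le_norm_to_real:
  obtains C where "C > 0" "\<And>x. \<bar>of_rat (norm_form x)\<bar> \<le> C * (norm (to_real x))\<^sup>2"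
proof
  let ?c = "of_rat c :: real" and ?d = "of_rat d :: real"
  let ?C = "1 + \<bar>?c\<bar> + \<bar>?d\<bar> + \<bar>?c * ?d\<bar>"
  show "?C > 0" by (intro add_pos_nonneg) auto
  fix x
  obtain t u v w where x: "x = quat (t, u, v, w)" by (rule quat_cases)
  define T U V W where TUVW: "T = (of_rat t :: real)" "U = (of_rat u :: real)"
    "V = (of_rat v :: real)" "W = (of_rat w :: real)"
  define n where "n = norm (to_real x)"
  have r: "to_real x = (T, U, V, W)" by (simp add: x to_real_quat TUVW)
  have le: "\<bar>T\<bar> \<le> n" "\<bar>U\<bar> \<le> n" "\<bar>V\<bar> \<le> n" "\<bar>W\<bar> \<le> n"
  proof -
    have "norm T \<le> n" "norm (U, V, W) \<le> n"
      unfolding n_def r using norm_fst_le[of T "(U, V, W)"] norm_snd_le[of "(U, V, W)" T] by auto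
    moreover have "norm U \<le> norm (U, V, W)" "norm (V, W) \<le> norm (U, V, W)"
      using norm_fst_le[of U "(V, W)"] norm_snd_le[of "(V, W)" U] by auto
    moreover have "norm V \<le> norm (V, W)" "norm W \<le> norm (V, W)"
      using norm_fst_le[of V W] norm_snd_le[of W V] by auto
    ultimately show "\<bar>T\<bar> \<le> n" "\<bar>U\<bar> \<le> n" "\<bar>V\<bar> \<le> n" "\<bar>W\<bar> \<le> n" by simp_all
  qed
  have sq: "y\<^sup>2 \<le> n\<^sup>2" if "\<bar>y\<bar> \<le> n" for y :: real
    using that by (metis abs_ge_zero power2_abs power_mono)
  have "of_rat (norm_form x) = T\<^sup>2 - ?c * U\<^sup>2 - ?d * V\<^sup>2 + ?c * ?d * W\<^sup>2"
    by (simp add: x nrd_quat TUVW of_rat_add of_rat_diff of_rat_mult of_rat_power)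
  also have "\<bar>\<dots>\<bar> \<le> \<bar>T\<^sup>2\<bar> + \<bar>?c * U\<^sup>2\<bar> + \<bar>?d * V\<^sup>2\<bar> + \<bar>?c * ?d * W\<^sup>2\<bar>" by linarith
  also have "\<dots> = T\<^sup>2 + \<bar>?c\<bar> * U\<^sup>2 + \<bar>?d\<bar> * V\<^sup>2 + \<bar>?c * ?d\<bar> * W\<^sup>2" by (simp only: abs_mult abs_power2)
  also have "\<dots> \<le> n\<^sup>2 + \<bar>?c\<bar> * n\<^sup>2 + \<bar>?d\<bar> * n\<^sup>2 + \<bar>?c * ?d\<bar> * n\<^sup>2"
    using le sq by (intro add_mono mult_left_mono) auto
  also have "\<dots> = ?C * n\<^sup>2" by (simp only: distrib_right mult_1_left)
  finally show "\<bar>of_rat (norm_form x)\<bar> \<le> ?C * (norm (to_real x))\<^sup>2" by (simp only: n_def)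
qed

end

locale arch_normed_quaternion_algebra = division_quaternion_algebra scl c d i j
  for scl :: "rat \<Rightarrow> 'b::division_ring \<Rightarrow> 'b" and c d :: rat and i j :: 'b +
  fixes N :: "real quad \<Rightarrow> real"
  assumes arch_norm: "is_arch_norm c d N"
begin

abbreviation anorm :: "'b \<Rightarrow> real" where "anorm x \<equiv> N (to_real x)"

text \<open>Besides being a submultiplicative seminorm, the archimedean norm bounds the square root of the
  reduced norm up to a constant. The constant is harmless, because the bound will be applied to
  high powers; it comes from the injectivity of the embedding into matrices, which makes the operator norm dominate the size of the coordinates.\<close>

lemma
  shows anorm_nonneg: "anorm x \<ge> 0" (is ?pos)
    and anorm_mult: "anorm (x * y) \<le> anorm x * anorm y" (is ?mult)
    and anorm_add: "anorm (x + y) \<le> anorm x + anorm y" (is ?add)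
    and anorm_minus: "anorm (- x) = anorm x" (is ?minus)
    and nrd_le_anorm_square: "\<exists>C>0. \<forall>x. \<bar>of_rat (norm_form x)\<bar> \<le> C * (anorm x)\<^sup>2" (is ?nrd)
proof -
  have main: "?pos \<and> ?mult \<and> ?add \<and> ?minus \<and> ?nrd"
    if hom: "real_alg_hom c d \<phi>" and inj: "inj \<phi>" and N: "N = (\<lambda>x. onorm (\<lambda>v. \<phi> x *v v))"
    for \<phi> :: "real quad \<Rightarrow> 'k::{euclidean_space, real_algebra_1} ^ 2 ^ 2"
  proof (intro conjI)
    have lin: "linear \<phi>" using hom by (simp add: real_alg_hom_def)
    have bl: "bounded_linear (\<lambda>v. A *v v)" for A :: "'k ^ 2 ^ 2"
      by (rule matrix_vector_mul_bounded_linear)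
    show ?pos unfolding N by (rule onorm_pos_le[OF bl])
    have "\<phi> (to_real (x * y)) = \<phi> (to_real x) ** \<phi> (to_real y)"
      unfolding to_real_mult using hom unfolding real_alg_hom_def by blast
    then have "(\<lambda>v. \<phi> (to_real (x * y)) *v v) = (\<lambda>v. \<phi> (to_real x) *v v) \<circ> (\<lambda>v. \<phi> (to_real y) *v v)"
      by (simp add: fun_eq_iff matrix_vector_mul_assoc)
    then show ?mult unfolding N using onorm_compose[OF bl bl] by simp
    have "(\<lambda>v. \<phi> (to_real (x + y)) *v v) = (\<lambda>v. \<phi> (to_real x) *v v + \<phi> (to_real y) *v v)"
      by (simp add: to_real_add linear_add[OF lin] matrix_vector_mult_add_rdistrib)
    then show ?add unfolding N using onorm_triangle[OF bl bl] by simp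
    have "(\<lambda>v. \<phi> (to_real (- x)) *v v) = (\<lambda>v. - (\<phi> (to_real x) *v v))"
      by (simp add: to_real_minus linear_neg[OF lin] fun_eq_iff vec_eq_iff matrix_vector_mult_def sum_negf)
    then show ?minus unfolding N using onorm_neg by simp
    obtain C where C: "C > 0" "\<And>x. \<bar>of_rat (norm_form x)\<bar> \<le> C * (norm (to_real x))\<^sup>2"
      using nrd_le_norm_to_real by blast
    obtain b where b: "b > 0" "\<And>y. b * norm y \<le> norm (\<phi> y)"
      using linear_inj_bounded_below_pos[OF lin inj] by blast
    obtain K where K: "K > 0" "\<And>A :: 'k ^ 2 ^ 2. norm A \<le> K * onorm (\<lambda>v. A *v v)"
      using norm_matrix_le_onorm by blast
    have "\<bar>of_rat (norm_form x)\<bar> \<le> C * (K / b)\<^sup>2 * (anorm x)\<^sup>2" for x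
    proof -
      have "b * norm (to_real x) \<le> K * anorm x"
        using b(2)[of "to_real x"] K(2)[of "\<phi> (to_real x)"] unfolding N by linarith
      then have "norm (to_real x) \<le> K / b * anorm x" using b(1) by (simp add: field_simps)
      then have "(norm (to_real x))\<^sup>2 \<le> (K / b * anorm x)\<^sup>2" by (rule power_mono) simp
      then have "C * (norm (to_real x))\<^sup>2 \<le> C * (K / b * anorm x)\<^sup>2" using C by (intro mult_left_mono) auto
      also have "\<dots> = C * (K / b)\<^sup>2 * (anorm x)\<^sup>2" by (simp only: power_mult_distrib mult.assoc)
      finally show ?thesis using C(2)[of x] by linarith
    qed
    moreover have "C * (K / b)\<^sup>2 > 0" using b K C by simp
    ultimately show ?nrd by blast
  qed
  have "?pos \<and> ?mult \<and> ?add \<and> ?minus \<and> ?nrd"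
  proof (cases "definite c d")
    case True
    then obtain \<phi> :: "real quad \<Rightarrow> complex ^ 2 ^ 2" where
      "real_alg_hom c d \<phi>" "inj \<phi>" "N = (\<lambda>x. onorm (\<lambda>v. \<phi> x *v v))"
      using arch_norm by (auto simp: is_arch_norm_def)
    then show ?thesis by (rule main)
  next
    case False
    then obtain \<phi> :: "real quad \<Rightarrow> real ^ 2 ^ 2" where
      "real_alg_hom c d \<phi>" "bij \<phi>" "N = (\<lambda>x. onorm (\<lambda>v. \<phi> x *v v))"
      using arch_norm by (auto simp: is_arch_norm_def)
    then show ?thesis using bij_is_inj by (intro main)
  qed
  then show ?pos ?mult ?add ?minus ?nrd by blast+
qed

end

section \<open>Products of continued fraction matrices\<close>

lemma theta_square: "(theta x)\<^sup>2 = cmod x * theta x + 1"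
proof -
  have "(sqrt ((cmod x)\<^sup>2 + 4))\<^sup>2 = (cmod x)\<^sup>2 + 4" by simp
  then show ?thesis unfolding theta_def by (simp add: field_simps power2_eq_square)
qed

lemma theta_pos: "theta x > 0"
  unfolding theta_def by (intro divide_pos_pos add_nonneg_pos real_sqrt_gt_zero) (auto intro: add_nonneg_pos)

text \<open>The symmetric matrix with rows \<open>(a, 1)\<close> and \<open>(1, 0)\<close> has eigenvalues \<open>\<theta>(a)\<close> and \<open>- 1 / \<theta>(a)\<close>,
  hence Euclidean operator norm \<open>\<theta>(a)\<close>; the slack in the inequality is a multiple of the
  square of \<open>U - \<theta> V\<close>, which vanishes on the top eigenvector.\<close>

lemma theta_bound:
  assumes "a \<ge> 0" and th: "\<theta> = theta (complex_of_real a)"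
  shows "(a * U + V)\<^sup>2 + U\<^sup>2 \<le> \<theta>\<^sup>2 * (U\<^sup>2 + V\<^sup>2)"
proof -
  have pos: "\<theta> > 0" using theta_pos th by simp
  have sq: "\<theta>\<^sup>2 = a * \<theta> + 1" using theta_square[of "complex_of_real a"] assms by simp
  have "\<theta> * (\<theta>\<^sup>2 * (U\<^sup>2 + V\<^sup>2) - ((a * U + V)\<^sup>2 + U\<^sup>2)) =
      a * (U - \<theta> * V)\<^sup>2 + (\<theta>\<^sup>2 - (a * \<theta> + 1)) * ((\<theta> + a) * U\<^sup>2 + \<theta> * V\<^sup>2)"
    by (simp add: power2_eq_square algebra_simps)
  also have "\<dots> = a * (U - \<theta> * V)\<^sup>2" using sq by simp
  finally have "\<theta> * (\<theta>\<^sup>2 * (U\<^sup>2 + V\<^sup>2) - ((a * U + V)\<^sup>2 + U\<^sup>2)) = a * (U - \<theta> * V)\<^sup>2" .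
  moreover have "a * (U - \<theta> * V)\<^sup>2 \<ge> 0" using assms by simp
  ultimately show ?thesis using pos by (metis diff_ge_0_iff_ge zero_le_mult_iff order_less_not_sym order_le_less)
qed

text \<open>The matrix with rows \<open>(a, 1)\<close> and \<open>(1, 0)\<close>, acting on column vectors.
  In homogeneous coordinates this is \<open>x \<mapsto> a + 1/x\<close>, so products of such
  matrices are the partial evaluations of a continued fraction.\<close>

definition cf_step :: "'b::ring_1 \<Rightarrow> 'b \<times> 'b \<Rightarrow> 'b \<times> 'b" where
  "cf_step a w = (a * fst w + snd w, fst w)"

abbreviation cf_apply :: "'b::ring_1 list \<Rightarrow> 'b \<times> 'b \<Rightarrow> 'b \<times> 'b" where
  "cf_apply as w \<equiv> foldr cf_step as w"

lemma cf_apply_continuants: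
  "cf_apply (map a [0..<Suc m]) (u, v) =
    (contA a (Suc m) * u + contA a m * v, contB a (Suc m) * u + contB a m * v)"
proof (induction m arbitrary: u v)
  case 0
  show ?case by (simp add: cf_step_def)
next
  case (Suc m)
  have "cf_apply (map a [0..<Suc (Suc m)]) (u, v) = cf_apply (map a [0..<Suc m]) (a (Suc m) * u + v, u)"
    by (simp add: cf_step_def)
  also have "\<dots> = (contA a (Suc (Suc m)) * u + contA a (Suc m) * v,
      contB a (Suc (Suc m)) * u + contB a (Suc m) * v)"
    unfolding Suc by (simp add: algebra_simps)
  finally show ?case .
qed

text \<open>The matrices act on the left, so they commute with scalars on the right.\<close>

lemma cf_apply_mult_right:
  "cf_apply as (u * \<mu>, v * \<mu>) = (fst (cf_apply as (u, v)) * \<mu>, snd (cf_apply as (u, v)) * \<mu>)"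
  by (induction as) (auto simp: cf_step_def distrib_right mult.assoc)

text \<open>The inverse of the matrix with rows \<open>(a, 1)\<close> and \<open>(1, 0)\<close> is the matrix of the same shape for
  \<open>- a\<close>, conjugated by the exchange of the two coordinates.\<close>

lemma cf_apply_inverse:
  "cf_apply (map uminus (rev as)) (prod.swap (cf_apply as w)) = prod.swap w"
  by (induction as) (simp_all add: cf_step_def prod.swap_def)

locale ramified_normed_quaternion_algebra =
  ramified_quaternion_algebra scl c d i j p + arch_normed_quaternion_algebra scl c d i j N
  for scl :: "rat \<Rightarrow> 'b::division_ring \<Rightarrow> 'b" and c d :: rat and i j :: 'b
    and p :: nat and N :: "real quad \<Rightarrow> real"
begin

abbreviation th :: "'b \<Rightarrow> real" where
  "th a \<equiv> theta (complex_of_real (anorm a))"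

lemma cf_apply_anorm:
  "(anorm (fst (cf_apply as w)))\<^sup>2 + (anorm (snd (cf_apply as w)))\<^sup>2
    \<le> (prod_list (map th as))\<^sup>2 * ((anorm (fst w))\<^sup>2 + (anorm (snd w))\<^sup>2)"
proof (induction as)
  case (Cons a as)
  obtain u v where uv: "cf_apply as w = (u, v)" by fastforce
  have "anorm (a * u + v) \<le> anorm a * anorm u + anorm v"
    using anorm_mult[of a u] anorm_add[of "a * u" v] by linarith
  then have "(anorm (a * u + v))\<^sup>2 \<le> (anorm a * anorm u + anorm v)\<^sup>2"
    by (intro power_mono anorm_nonneg)
  then have "(anorm (a * u + v))\<^sup>2 + (anorm u)\<^sup>2 \<le> (th a)\<^sup>2 * ((anorm u)\<^sup>2 + (anorm v)\<^sup>2)"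
    using theta_bound[OF anorm_nonneg refl, of a "anorm u" "anorm v"] by linarith
  also have "\<dots> \<le> (th a)\<^sup>2 * ((prod_list (map th as))\<^sup>2 * ((anorm (fst w))\<^sup>2 + (anorm (snd w))\<^sup>2))"
    using Cons uv by (intro mult_left_mono) auto
  finally show ?case using cf_step_def[of a "(u, v)"] by (simp add: uv power_mult_distrib mult.assoc)
qed simp

lemma cf_apply_order_away:
  assumes R: "is_order scl R" and "set as \<subseteq> order_away p R"
    and "fst w \<in> order_away p R" "snd w \<in> order_away p R"
  shows "fst (cf_apply as w) \<in> order_away p R \<and> snd (cf_apply as w) \<in> order_away p R"
  using assms(2-)
  by (induction as) (auto simp: cf_step_def intro!: order_away_add[OF R] order_away_mult[OF R])

text \<open>On a vector whose first coordinate dominates, \<open>|a u + v| = |a| |u|\<close> because \<open>|a u| > |u| \<ge> |v|\<close>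
  unless both coordinates vanish; the new vector is again of this kind.\<close>

lemma cf_apply_vabs:
  assumes "\<forall>a\<in>set as. vabs a > 1" and "vabs (snd w) \<le> vabs (fst w)"
  shows "vabs (snd (cf_apply as w)) \<le> vabs (fst (cf_apply as w)) \<and>
    vabs (fst (cf_apply as w)) = prod_list (map vabs as) * vabs (fst w)"
  using assms(1)
proof (induction as)
  case (Cons a as)
  obtain u v where uv: "cf_apply as w = (u, v)" by fastforce
  have IH: "vabs v \<le> vabs u" "vabs u = prod_list (map vabs as) * vabs (fst w)" and a: "vabs a > 1"
    using Cons uv by auto
  have au: "vabs (a * u + v) = vabs a * vabs u"
  proof (cases "u = 0")
    case True
    then have "v = 0" using IH(1) vabs_nonneg[of v] vabs_eq_0_iff[of v] by simp
    with True show ?thesis by simp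
  next
    case False
    then have "vabs u > 0" by (simp add: order_less_le)
    then have "vabs v < vabs (a * u)" using IH(1) a by (simp add: vabs_mult order_le_less_trans)
    then have "vabs (a * u + v) = vabs (a * u)" by (rule vabs_add_dominant)
    then show ?thesis by (simp add: vabs_mult)
  qed
  have "vabs u \<le> vabs a * vabs u" using mult_right_mono[of 1 "vabs a" "vabs u"] a by simp
  then show ?case using au IH cf_step_def[of a "(u, v)"] by (simp add: uv)
qed (use assms in simp)

text \<open>All the vectors \<open>w \<mu>\<^sup>k\<close> are integral away from \<open>p\<close> up to a fixed denominator, and grow at most
  like \<open>\<Theta>\<^sup>k\<close>, where \<open>\<Theta>\<close> is the product of the \<open>\<theta>\<close>'s. By the product formula for the norm of a nonzero
  coordinate, \<open>(|\<mu>|\<^sub>p \<Theta>)\<^sup>k\<close> stays away from zero.\<close>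

lemma eigenvalue_bound:
  assumes R: "is_order scl R" and as: "set as \<subseteq> order_away p R"
    and w: "w \<noteq> (0, 0)" and eig: "cf_apply as w = (fst w * \<mu>, snd w * \<mu>)"
  shows "vabs \<mu> * prod_list (map th as) \<ge> 1"
proof (rule ccontr)
  let ?\<Theta> = "prod_list (map th as)"
  have \<Theta>0: "?\<Theta> \<ge> 0" by (induction as) (auto simp: less_imp_le[OF theta_pos])
  define \<rho> where "\<rho> = vabs \<mu> * ?\<Theta>"
  assume "\<not> vabs \<mu> * ?\<Theta> \<ge> 1"
  then have \<rho>: "0 \<le> \<rho>" "\<rho> < 1" using \<Theta>0 by (simp_all add: \<rho>_def)
  have \<mu>0: "\<mu> \<noteq> 0"
  proof
    assume "\<mu> = 0"
    then have "prod.swap w = cf_apply (map uminus (rev as)) (0, 0)"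
      using eig cf_apply_inverse[of as w] by (simp add: prod.swap_def)
    also have "\<dots> = (0, 0)" using cf_apply_mult_right[of "map uminus (rev as)" 0 0 0] by simp
    finally show False using w by (cases w) simp
  qed
  \<comment> \<open>Clear the denominators of the eigenvector, whose coordinates are arbitrary in \<open>B\<close>.\<close>
  obtain m1 m2 :: int where m: "m1 > 0" "of_int m1 * fst w \<in> R" "m2 > 0" "of_int m2 * snd w \<in> R"
    using order_multiple[OF R] by metis
  define D where "D = m1 * m2"
  have D: "D > 0" using m by (simp add: D_def)
  define w' where "w' = (of_int D * fst w, of_int D * snd w)"
  have "of_int D * fst w = of_int m2 * (of_int m1 * fst w)"
    by (simp add: D_def mult.commute[of m1] mult.assoc)
  moreover have "of_int D * snd w = of_int m1 * (of_int m2 * snd w)"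
    by (simp add: D_def mult.assoc)
  ultimately have w'R: "fst w' \<in> R" "snd w' \<in> R"
    using order_of_int_mult[OF R m(2)] order_of_int_mult[OF R m(4)] by (simp_all add: w'_def)
  have eig': "cf_apply as (fst w' * \<nu>, snd w' * \<nu>) = (fst w' * (\<mu> * \<nu>), snd w' * (\<mu> * \<nu>))" for \<nu>
  proof -
    have comm: "of_int D * x = x * of_int D" for x :: 'b by (rule mult_of_int_commute)
    have "cf_apply as (fst w' * \<nu>, snd w' * \<nu>) =
        (fst (cf_apply as w) * (of_int D * \<nu>), snd (cf_apply as w) * (of_int D * \<nu>))"
      using cf_apply_mult_right[of as "fst w" "of_int D * \<nu>" "snd w"]
      by (simp add: w'_def comm mult.assoc)
    then show ?thesis by (simp add: eig w'_def comm mult.assoc mult_of_int_commute)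
  qed
  define F where "F = (anorm (fst w'))\<^sup>2 + (anorm (snd w'))\<^sup>2"
  have iter: "fst w' * \<mu> ^ k \<in> order_away p R \<and> snd w' * \<mu> ^ k \<in> order_away p R \<and>
      (anorm (fst w' * \<mu> ^ k))\<^sup>2 + (anorm (snd w' * \<mu> ^ k))\<^sup>2 \<le> (?\<Theta>\<^sup>2) ^ k * F" for k
  proof (induction k)
    case 0
    show ?case using w'R order_away_subset by (auto simp: F_def)
  next
    case (Suc k)
    let ?z = "(fst w' * \<mu> ^ k, snd w' * \<mu> ^ k)"
    have z: "cf_apply as ?z = (fst w' * \<mu> ^ Suc k, snd w' * \<mu> ^ Suc k)" using eig' by simp
    have "(anorm (fst w' * \<mu> ^ Suc k))\<^sup>2 + (anorm (snd w' * \<mu> ^ Suc k))\<^sup>2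
        \<le> ?\<Theta>\<^sup>2 * ((anorm (fst w' * \<mu> ^ k))\<^sup>2 + (anorm (snd w' * \<mu> ^ k))\<^sup>2)"
      using cf_apply_anorm[of as ?z] unfolding z by simp
    also have "\<dots> \<le> ?\<Theta>\<^sup>2 * ((?\<Theta>\<^sup>2) ^ k * F)" using Suc by (intro mult_left_mono) auto
    finally show ?case
      using cf_apply_order_away[OF R as, of ?z] Suc unfolding z by (simp add: mult.assoc)
  qed
  obtain z where z: "z \<noteq> 0" and zk: "\<And>k. z * \<mu> ^ k \<in> order_away p R"
    and zF: "\<And>k. (anorm (z * \<mu> ^ k))\<^sup>2 \<le> (?\<Theta>\<^sup>2) ^ k * F"
  proof (cases "fst w = 0")
    case False
    show thesis
    proof (rule that)
      show "fst w' \<noteq> 0" using False D by (simp add: w'_def scl_of_int[symmetric])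
      show "(anorm (fst w' * \<mu> ^ k))\<^sup>2 \<le> (?\<Theta>\<^sup>2) ^ k * F" for k
        using iter[of k] zero_le_power2[of "anorm (snd w' * \<mu> ^ k)"] by linarith
    qed (use iter in blast)
  next
    case True
    then have "snd w \<noteq> 0" using w by (cases w) auto
    show thesis
    proof (rule that)
      show "snd w' \<noteq> 0" using \<open>snd w \<noteq> 0\<close> D by (simp add: w'_def scl_of_int[symmetric])
      show "(anorm (snd w' * \<mu> ^ k))\<^sup>2 \<le> (?\<Theta>\<^sup>2) ^ k * F" for k
        using iter[of k] zero_le_power2[of "anorm (fst w' * \<mu> ^ k)"] by linarith
    qed (use iter in blast)
  qed
  obtain E :: int where E: "E > 0" "\<And>x. x \<in> R \<Longrightarrow> of_int E * norm_form x \<in> \<int>"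
    using order_nrd_denominator[OF R] by blast
  obtain C where C: "C > 0" "\<And>x. \<bar>of_rat (norm_form x)\<bar> \<le> C * (anorm x)\<^sup>2"
    using nrd_le_anorm_square by blast
  define K where "K = rat_abs p (of_int E * norm_form z) * (of_int E * C * F)"
  have "1 \<le> K * (\<rho>\<^sup>2) ^ k" for k
  proof -
    let ?y = "of_int E * norm_form (z * \<mu> ^ k)"
    obtain e where e: "of_int (int p ^ e) * (z * \<mu> ^ k) \<in> R" using zk[of k] by (auto simp: order_away_def)
    have "norm_form (of_int (int p ^ e) * (z * \<mu> ^ k)) = of_nat p ^ (2 * e) * norm_form (z * \<mu> ^ k)"
      unfolding scl_of_int[symmetric] nrd_scale by (simp add: power_mult[symmetric] mult.commute)
    then have "of_nat p ^ (2 * e) * ?y \<in> \<int>" using E(2)[OF e] by (simp add: mult_ac)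
    moreover have "?y \<noteq> 0" using E z \<mu>0 by simp
    ultimately have "1 \<le> rat_abs p ?y * \<bar>of_rat ?y\<bar>" using product_formula_bound by blast
    also have "rat_abs p ?y = rat_abs p (of_int E * norm_form z) * (vabs \<mu>)\<^sup>2 ^ k"
      by (simp add: nrd_mult nrd_power rat_abs_mult rat_abs_power vabs_square)
    also have "\<bar>of_rat ?y\<bar> = of_int E * \<bar>of_rat (norm_form (z * \<mu> ^ k)) :: real\<bar>"
      using E by (simp add: of_rat_mult abs_mult)
    also have "rat_abs p (of_int E * norm_form z) * (vabs \<mu>)\<^sup>2 ^ k * (of_int E * \<bar>of_rat (norm_form (z * \<mu> ^ k))\<bar>)
        \<le> rat_abs p (of_int E * norm_form z) * (vabs \<mu>)\<^sup>2 ^ k * (of_int E * (C * ((?\<Theta>\<^sup>2) ^ k * F)))"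
    proof (intro mult_left_mono)
      have "C * (anorm (z * \<mu> ^ k))\<^sup>2 \<le> C * ((?\<Theta>\<^sup>2) ^ k * F)" using C zF by (intro mult_left_mono) auto
      then show "\<bar>of_rat (norm_form (z * \<mu> ^ k))\<bar> \<le> C * ((?\<Theta>\<^sup>2) ^ k * F)"
        using C(2)[of "z * \<mu> ^ k"] by linarith
    qed (use E in auto)
    also have "\<dots> = K * (\<rho>\<^sup>2) ^ k" by (simp add: K_def \<rho>_def power_mult_distrib mult_ac)
    finally show ?thesis .
  qed
  moreover have "(\<lambda>k. K * (\<rho>\<^sup>2) ^ k) \<longlonglongrightarrow> K * 0"
    using \<rho> by (intro tendsto_mult_left LIMSEQ_power_zero) (simp add: abs_square_less_1)
  ultimately have "1 \<le> K * 0" by (intro LIMSEQ_le_const) auto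
  then show False by simp
qed

text \<open>On a dominated vector the eigenvalue \<open>\<mu>\<close> is \<open>p\<close>-adically as large as the product of the entries,
  so its inverse, an eigenvalue of the inverse product, is too small for the bound above.\<close>

lemma no_dominated_eigenvector:
  assumes R: "is_order scl R" and as: "set as \<subseteq> order_away p R" and "as \<noteq> []"
    and big: "\<forall>a\<in>set as. vabs a > 1" and th_less: "\<forall>a\<in>set as. th a < vabs a"
    and w: "w \<noteq> (0, 0)" and dom: "vabs (snd w) \<le> vabs (fst w)"
  shows "cf_apply as w \<noteq> (fst w * \<mu>, snd w * \<mu>)"
proof
  assume eig: "cf_apply as w = (fst w * \<mu>, snd w * \<mu>)"
  have "fst w \<noteq> 0"
  proof
    assume 0: "fst w = 0"
    then have "vabs (snd w) = 0" using dom vabs_nonneg[of "snd w"] by simp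
    then show False using 0 w by (simp add: prod_eq_iff)
  qed
  then have \<mu>: "vabs \<mu> = prod_list (map vabs as)"
    using cf_apply_vabs[OF big dom] by (simp add: eig vabs_mult)
  have less: "0 < prod_list (map th as) \<and> prod_list (map th as) < prod_list (map vabs as)"
    using \<open>as \<noteq> []\<close> th_less
  proof (induction as rule: list_nonempty_induct)
    case (cons a as)
    then show ?case using theta_pos by (auto intro!: mult_strict_mono mult_pos_pos intro: less_trans[OF theta_pos])
  qed (simp add: theta_pos)
  then have \<mu>0: "\<mu> \<noteq> 0" using \<mu> by auto
  \<comment> \<open>Changing signs preserves \<open>\<theta>\<close> and \<open>R[1/p]\<close>, so the inverse product obeys the same bound.\<close>
  let ?as' = "map uminus (rev as)"
  have "cf_apply ?as' (snd w * \<mu>, fst w * \<mu>) = prod.swap w"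
    using cf_apply_inverse[of as w] by (simp add: eig prod.swap_def)
  then have "cf_apply ?as' (prod.swap w) = (fst (prod.swap w) * inverse \<mu>, snd (prod.swap w) * inverse \<mu>)"
    using cf_apply_mult_right[of ?as' "snd w * \<mu>" "inverse \<mu>" "fst w * \<mu>"] \<mu>0
    by (simp add: mult.assoc prod.swap_def)
  then have "vabs (inverse \<mu>) * prod_list (map th ?as') \<ge> 1"
    using as w order_away_minus[OF R]
    by (intro eigenvalue_bound[OF R, of _ "prod.swap w"]) (auto simp: prod_eq_iff)
  moreover have "prod_list (map th ?as') = prod_list (map th as)"
    by (induction as) (simp_all add: anorm_minus mult.commute)
  ultimately have "1 \<le> prod_list (map th as) / vabs \<mu>"
    by (simp only: vabs_inverse divide_inverse mult.commute)
  then show False using \<mu> less by (simp add: le_divide_eq)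
qed

end

section \<open>Periodic expansions have no limit in the algebra\<close>

theorem theorem7p4:
  fixes scl :: "rat \<Rightarrow> 'b::division_ring \<Rightarrow> 'b"
    and c d :: rat and i j :: 'b
    and p n :: nat and a :: "nat \<Rightarrow> 'b"
    and N :: "real quad \<Rightarrow> real"
  assumes B: "quaternion_algebra scl c d i j"
    and p: "Factorial_Ring.prime p" "odd p" "ramified_at c d p"
    and N: "is_arch_norm c d N"
    and R: "\<exists>R. maximal_order scl R \<and>
      (\<forall>k\<le>n. \<forall>l\<le>n.
         quat_abs scl c d i j p (a k) > 1 \<and>
         (\<forall>q. Factorial_Ring.prime q \<and> q \<noteq> p \<longrightarrow>
            to_quat_Qp scl i j q (a k) \<in> local_order scl c d i j R q) \<and>
         (quat_abs scl c d i j p (a k - a l) < 1 \<longrightarrow> a k = a l) \<and>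
         theta (complex_of_real (N (to_quat_real scl i j (a k))))
           / quat_abs scl c d i j p (a k) < 1)"
  shows "\<not> (\<exists>x. x * contB a (Suc n) * x + x * contB a n - contA a (Suc n) * x - contA a n = 0)"
proof
  interpret quaternion_algebra scl c d i j by (rule B)
  interpret ramified_normed_quaternion_algebra scl c d i j p N
    by unfold_locales (use p N in auto)
  obtain R where "maximal_order scl R"
    and big: "\<And>k. k \<le> n \<Longrightarrow> vabs (a k) > 1"
    and loc: "\<And>k q. k \<le> n \<Longrightarrow> Factorial_Ring.prime q \<Longrightarrow> q \<noteq> p \<Longrightarrow>
        to_quat_Qp scl i j q (a k) \<in> local_order scl c d i j R q"
    and th: "\<And>k. k \<le> n \<Longrightarrow> th (a k) / vabs (a k) < 1"
    using R by blast
  then have R: "is_order scl R" by (simp add: maximal_order_def)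
  define as where "as = map a [0..<Suc n]"
  have mem: "\<exists>k\<le>n. b = a k" if "b \<in> set as" for b
    using that by (auto simp: as_def less_Suc_eq_le simp del: upt_Suc)
  have as: "as \<noteq> []" "\<forall>b\<in>set as. vabs b > 1" "\<forall>b\<in>set as. th b < vabs b" "set as \<subseteq> order_away p R"
  proof -
    show "as \<noteq> []" by (simp add: as_def)
    show "\<forall>b\<in>set as. vabs b > 1" using mem big by blast
    show "\<forall>b\<in>set as. th b < vabs b"
    proof
      fix b assume "b \<in> set as"
      then obtain k where k: "k \<le> n" "b = a k" using mem by blast
      then show "th b < vabs b" using th[of k] big[of k] by (simp add: divide_less_eq)
    qed
    show "set as \<subseteq> order_away p R"
      using mem loc local_order_integral[OF _ R] order_at_all_imp_order_away[OF prime_p R] by blast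
  qed
  assume "\<exists>x. x * contB a (Suc n) * x + x * contB a n - contA a (Suc n) * x - contA a n = 0"
  then obtain x where x: "x * contB a (Suc n) * x + x * contB a n - contA a (Suc n) * x - contA a n = 0" ..
  define \<mu> where "\<mu> = contB a (Suc n) * x + contB a n"
  have "contA a (Suc n) * x + contA a n = x * \<mu>"
    using x by (simp add: \<mu>_def distrib_left mult.assoc algebra_simps)
  then have eig: "cf_apply as (x, 1) = (x * \<mu>, 1 * \<mu>)"
    using cf_apply_continuants[of a n x 1] by (simp add: as_def \<mu>_def)
  show False
  proof (cases "vabs x \<ge> 1")
    case True
    then show False
      using no_dominated_eigenvector[OF R as(4) as(1-3), of "(x, 1)" \<mu>] eig by simp
  next
    \<comment> \<open>The second coordinate dominates, which becomes the first one for the inverse product.\<close>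
    case False
    let ?as' = "map uminus (rev as)"
    have inv: "cf_apply ?as' (1 * \<mu>, x * \<mu>) = (1, x)"
      using cf_apply_inverse[of as "(x, 1)"] by (simp add: eig)
    have "\<mu> \<noteq> 0"
    proof
      assume "\<mu> = 0"
      then have "cf_apply ?as' (0, 0) = (1, x)" using inv by simp
      then show False using cf_apply_mult_right[of ?as' 0 0 0] by simp
    qed
    then have "cf_apply ?as' (1, x) = (1 * inverse \<mu>, x * inverse \<mu>)"
      using cf_apply_mult_right[of ?as' "1 * \<mu>" "inverse \<mu>" "x * \<mu>"] inv by (simp add: mult.assoc)
    moreover have "cf_apply ?as' w \<noteq> (fst w * inverse \<mu>, snd w * inverse \<mu>)" if "w = (1, x)" for w
    proof (rule no_dominated_eigenvector[OF R])
      show "set ?as' \<subseteq> order_away p R" using as(4) order_away_minus[OF R] by auto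
    qed (use that False as in \<open>auto simp: anorm_minus\<close>)
    ultimately show False by fastforce
  qed
qed

end
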